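(* Let $a,q\in C^\infty(\mathbb{T}^1)$ with $a$ real valued and $q$ complex valued, and set $a_0=\frac{1}{2\pi}\int_0^{2\pi}a(t)\,dt$, $q_0=\frac{1}{2\pi}\int_0^{2\pi}q(t)\,dt$. Consider the differential operators on $\mathbb{T}^1\times\mathbb{R}$ $$L=\partial_t+a(t)\partial_x+q(t),\qquad L_0=\partial_t+a_0\partial_x+q_0.$$ Let $A(t)=\int_0^ta(s)\,ds-a_0t$ and $Q(t)=\int_0^tq(s)\,ds-q_0t$, and let $\Psi_a,\Psi_q:\mathcal{S}'(\mathbb{T}^1\times\mathbb{R})\to\mathcal{S}'(\mathbb{T}^1\times\mathbb{R})$ be given by $\Psi_au=\mathcal{F}_{\mathbb{R}}^{-1}\{e^{i\xi A(t)}\widehat{u}(t,\xi)\}$ and $\Psi_qu=e^{Q(t)}u$. Put $\Psi=\Psi_a\circ\Psi_q$. Then $$L_0\circ\Psi=\Psi\circ L\qquad\text{and}\qquad L\circ\Psi^{-1}=\Psi^{-1}\circ L_0.$$ Therefore $L$ is Schwartz globally hypoelliptic if and only if $L_0$ is Schwartz globally hypoelliptic.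
   Context: $\mathbb{T}^1=\mathbb{R}/2\pi\mathbb{Z}$, with variables $(t,x)\in\mathbb{T}^1\times\mathbb{R}$. $\mathcal{S}(\mathbb{T}^1\times\mathbb{R})$ is the Fréchet space of all complex-valued $f\in C^\infty(\mathbb{T}^1\times\mathbb{R})$ such that $\|f\|_{\alpha,\beta,\gamma}:=\sup_{(t,x)}|x^\gamma\partial_t^\alpha\partial_x^\beta f(t,x)|<+\infty$ for all nonnegative integers $\alpha,\beta,\gamma$, with seminorms $p_N(f):=\sum_{\alpha+\beta+\gamma\leq N}\|f\|_{\alpha,\beta,\gamma}$. $\mathcal{S}'(\mathbb{T}^1\times\mathbb{R})$ is its topological dual. Derivatives and multiplication by smooth functions all of whose derivatives have at most polynomial growth in the real variable, uniformly in $t$, act on $\mathcal{S}'$ in the usual dual sense. For $f\in\mathcal{S}(\mathbb{T}^1\times\mathbb{R})$, $\widehat{f}(t,\xi)=\mathcal{F}_{\mathbb{R}}(f)(t,\xi):=\int_{\mathbb{R}}f(t,x)e^{-ix\xi}\,dx$ and $\mathcal{F}_{\mathbb{R}}^{-1}(f)(t,x):=\frac{1}{2\pi}\int_{\mathbb{R}}f(t,\xi)e^{ix\xi}\,d\xi$; these extend to $u\in\mathcal{S}'(\mathbb{T}^1\times\mathbb{R})$ by $\langle\widehat{u},f\rangle=\langle u,\mathcal{F}_{\mathbb{R}}f\rangle$ and $\langle\mathcal{F}_{\mathbb{R}}^{-1}u,f\rangle=\langle u,\mathcal{F}_{\mathbb{R}}^{-1}f\rangle$. A differential operator $P:\mathcal{S}'(\mathbb{T}^1\times\mathbb{R})\to\mathcal{S}'(\mathbb{T}^1\times\mathbb{R})$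 is called Schwartz globally hypoelliptic (SGH) if whenever $u\in\mathcal{S}'(\mathbb{T}^1\times\mathbb{R})$ and $Pu\in\mathcal{S}(\mathbb{T}^1\times\mathbb{R})$, then $u\in\mathcal{S}(\mathbb{T}^1\times\mathbb{R})$. *)

theory Defs
  imports "HOL-Analysis.Analysis"
begin

text \<open>
  Functions on the circle are represented by \<open>2 * pi\<close>-periodic functions on the real line, and
  functions on the product of the circle with the real line by curried functions
  \<open>f t x\<close> that are \<open>2 * pi\<close>-periodic in \<open>t\<close>.
\<close>

definition smooth_circle :: "(real \<Rightarrow> 'a::real_normed_vector) set" where
  "smooth_circle =
     {g. (\<forall>k t. ((\<lambda>h s. vector_derivative h (at s)) ^^ k) g differentiable at t) \<and>
         (\<forall>t. g (t + 2 * pi) = g t)}"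

definition circle_mean :: "(real \<Rightarrow> 'a::{banach,second_countable_topology}) \<Rightarrow> 'a" where
  "circle_mean g = (1 / (2 * pi)) *\<^sub>R (LBINT s=0..2 * pi. g s)"

text \<open>The interval integral is oriented, so this is also the intended function for negative \<open>t\<close>.\<close>

definition mean_free_primitive ::
    "(real \<Rightarrow> 'a::{banach,second_countable_topology}) \<Rightarrow> real \<Rightarrow> 'a" where
  "mean_free_primitive g t = (LBINT s=0..t. g s) - t *\<^sub>R circle_mean g"

type_synonym cylfun = "real \<Rightarrow> real \<Rightarrow> complex"

definition D_t :: "cylfun \<Rightarrow> cylfun" where
  "D_t f = (\<lambda>t x. vector_derivative (\<lambda>s. f s x) (at t))"

definition D_x :: "cylfun \<Rightarrow> cylfun" where
  "D_x f = (\<lambda>t x. vector_derivative (\<lambda>y. f t y) (at x))"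

primrec C_k :: "nat \<Rightarrow> cylfun \<Rightarrow> bool" where
  "C_k 0 f \<longleftrightarrow> continuous_on UNIV (\<lambda>(t, x). f t x)"
| "C_k (Suc k) f \<longleftrightarrow>
     (\<forall>t x. (\<lambda>s. f s x) differentiable at t) \<and>
     (\<forall>t x. (\<lambda>y. f t y) differentiable at x) \<and>
     C_k k (D_t f) \<and> C_k k (D_x f)"

definition smooth_cylinder :: "cylfun set" where
  "smooth_cylinder = {f. (\<forall>k. C_k k f) \<and> (\<forall>t x. f (t + 2 * pi) x = f t x)}"

definition weighted_deriv :: "nat \<Rightarrow> nat \<Rightarrow> nat \<Rightarrow> cylfun \<Rightarrow> real \<times> real \<Rightarrow> real" where
  "weighted_deriv \<alpha> \<beta> \<gamma> f =
     (\<lambda>(t, x). norm (complex_of_real x ^ \<gamma> * (D_t ^^ \<alpha>) ((D_x ^^ \<beta>) f) t x))"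

definition schwartz :: "cylfun set" where
  "schwartz = {f \<in> smooth_cylinder. \<forall>\<alpha> \<beta> \<gamma>. bdd_above (range (weighted_deriv \<alpha> \<beta> \<gamma> f))}"

definition schwartz_norm :: "nat \<Rightarrow> nat \<Rightarrow> nat \<Rightarrow> cylfun \<Rightarrow> real" where
  "schwartz_norm \<alpha> \<beta> \<gamma> f = Sup (range (weighted_deriv \<alpha> \<beta> \<gamma> f))"

definition schwartz_seminorm :: "nat \<Rightarrow> cylfun \<Rightarrow> real" where
  "schwartz_seminorm N f =
     (\<Sum>(\<alpha>, \<beta>, \<gamma>) \<in> {(\<alpha>, \<beta>, \<gamma>). \<alpha> + \<beta> + \<gamma> \<le> N}. schwartz_norm \<alpha> \<beta> \<gamma> f)"

definition schwartz_ball :: "nat \<Rightarrow> cylfun \<Rightarrow> real \<Rightarrow> cylfun set" where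
  "schwartz_ball N f \<epsilon> = {g \<in> schwartz. schwartz_seminorm N (\<lambda>t x. g t x - f t x) < \<epsilon>}"

definition schwartz_topology :: "cylfun topology" where
  "schwartz_topology =
     topology_generated_by {schwartz_ball N f \<epsilon> |N f \<epsilon>. f \<in> schwartz \<and> \<epsilon> > 0}"

text \<open>
  Distributions are functionals on \<^const>\<open>schwartz\<close>; they are taken extensional, so that two of them
  are equal as HOL functions if and only if they agree on \<^const>\<open>schwartz\<close>.
\<close>

type_synonym functional = "cylfun \<Rightarrow> complex"

definition tempered :: "functional set" where
  "tempered = {u \<in> extensional schwartz.
     (\<forall>f\<in>schwartz. \<forall>g\<in>schwartz. u (\<lambda>t x. f t x + g t x) = u f + u g) \<and>
     (\<forall>c. \<forall>f\<in>schwartz. u (\<lambda>t x. c * f t x) = c * u f) \<and>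
     continuous_map schwartz_topology euclidean u}"

text \<open>The embedding of functions into distributions.\<close>

definition regular_dist :: "cylfun \<Rightarrow> functional" where
  "regular_dist g = (\<lambda>f\<in>schwartz.
     set_lebesgue_integral lborel ({0..2 * pi} \<times> UNIV) (\<lambda>(t, x). g t x * f t x))"

definition dist_add :: "functional \<Rightarrow> functional \<Rightarrow> functional" where
  "dist_add u v = (\<lambda>f\<in>schwartz. u f + v f)"

definition dist_mult :: "cylfun \<Rightarrow> functional \<Rightarrow> functional" where
  "dist_mult m u = (\<lambda>f\<in>schwartz. u (\<lambda>t x. m t x * f t x))"

definition dist_D_t :: "functional \<Rightarrow> functional" where
  "dist_D_t u = (\<lambda>f\<in>schwartz. - u (D_t f))"

definition dist_D_x :: "functional \<Rightarrow> functional" where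
  "dist_D_x u = (\<lambda>f\<in>schwartz. - u (D_x f))"

definition fourier :: "cylfun \<Rightarrow> cylfun" where
  "fourier f = (\<lambda>t \<xi>. LINT x|lborel. f t x * exp (- \<i> * of_real x * of_real \<xi>))"

definition inv_fourier :: "cylfun \<Rightarrow> cylfun" where
  "inv_fourier f =
     (\<lambda>t x. 1 / (2 * of_real pi) * (LINT \<xi>|lborel. f t \<xi> * exp (\<i> * of_real x * of_real \<xi>)))"

definition dist_fourier :: "functional \<Rightarrow> functional" where
  "dist_fourier u = (\<lambda>f\<in>schwartz. u (fourier f))"

definition dist_inv_fourier :: "functional \<Rightarrow> functional" where
  "dist_inv_fourier u = (\<lambda>f\<in>schwartz. u (inv_fourier f))"

definition transport_op :: "(real \<Rightarrow> real) \<Rightarrow> (real \<Rightarrow> complex) \<Rightarrow> functional \<Rightarrow> functional" where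
  "transport_op a q u =
     dist_add (dist_add (dist_D_t u) (dist_mult (\<lambda>t x. of_real (a t)) (dist_D_x u)))
              (dist_mult (\<lambda>t x. q t) u)"

definition mean_transport_op ::
    "(real \<Rightarrow> real) \<Rightarrow> (real \<Rightarrow> complex) \<Rightarrow> functional \<Rightarrow> functional" where
  "mean_transport_op a q = transport_op (\<lambda>t. circle_mean a) (\<lambda>t. circle_mean q)"

definition Psi_a :: "(real \<Rightarrow> real) \<Rightarrow> functional \<Rightarrow> functional" where
  "Psi_a a u = dist_inv_fourier
     (dist_mult (\<lambda>t \<xi>. exp (\<i> * of_real \<xi> * of_real (mean_free_primitive a t)))
       (dist_fourier u))"

definition Psi_q :: "(real \<Rightarrow> complex) \<Rightarrow> functional \<Rightarrow> functional" where
  "Psi_q q u = dist_mult (\<lambda>t x. exp (mean_free_primitive q t)) u"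

definition Psi :: "(real \<Rightarrow> real) \<Rightarrow> (real \<Rightarrow> complex) \<Rightarrow> functional \<Rightarrow> functional" where
  "Psi a q = Psi_a a \<circ> Psi_q q"

definition SGH :: "(functional \<Rightarrow> functional) \<Rightarrow> bool" where
  "SGH P \<longleftrightarrow>
     (\<forall>u\<in>tempered. P u \<in> regular_dist ` schwartz \<longrightarrow> u \<in> regular_dist ` schwartz)"

end

theory Submission
  imports Defs "HOL-Probability.Characteristic_Functions" "HOL-Probability.Sinc_Integral"
begin

text \<open>
  On the Fourier side \<open>\<Psi>\<^sub>a\<close> multiplies by \<open>exp (i \<xi> A(t))\<close>, so on functions \<open>\<Psi>\<close> is the weighted shear
  \<open>u(t,x) \<mapsto> exp (Q(t)) u(t, x + A(t))\<close>. On distributions it is the transpose of the operator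
  \<open>S f(t,x) = exp (Q(t)) f(t, x - A(t))\<close> on test functions. Once \<open>\<Psi>\<close> is known in this form
  (\<open>Psi_eq_transposed\<close>), every claim becomes a statement about \<open>S\<close>:

  \<^item> \<open>S\<close> is a continuous bijection of the Schwartz space, whose inverse has the same shape with \<open>-A\<close>
    and \<open>-Q\<close>. Hence \<open>\<Psi>\<close> is a bijection of the tempered distributions.

  \<^item> The chain rule together with \<open>A' = a - a\<^sub>0\<close> and \<open>Q' = q - q\<^sub>0\<close> shows that \<open>S\<close> conjugates the formal
    transposes of \<open>L\<^sub>0\<close> and \<open>L\<close> (\<open>conjugator_transport_adjoint\<close>). Transposing yields \<open>L\<^sub>0 \<Psi> = \<Psi> L\<close>,
    and applying \<open>\<Psi>\<^sup>-\<^sup>1\<close> on both sides gives the second identity.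

  \<^item> A shear preserves Lebesgue measure, so \<open>\<Psi>\<close> maps the distribution of a Schwartz function to the
    distribution of a Schwartz function, and onto these (\<open>Psi_regular_dist_image\<close>). The equivalence of
    the two hypoellipticity statements is then a change of variables \<open>u \<mapsto> \<Psi> u\<close>.

  Two analytic facts carry this. Operators such as \<open>S\<close>, multiplication by \<open>exp (i \<xi> A(t))\<close> and the partial
  Fourier transform must map the Schwartz space into itself, with seminorm estimates where continuity is
  needed; since their derivatives are sums of operators of the same kind, one coinduction principle
  (\<open>bounded_op_coinduct\<close>) covers all of them. And the identification of \<open>\<Psi>\<^sub>a\<close> rests on the Fourier
  inversion formula (\<open>fourier_inversion\<close>), proved here by Gaussian regularisation.
\<close>

section \<open>Smooth functions on the circle\<close>

abbreviation circle_deriv :: "(real \<Rightarrow> 'a::real_normed_vector) \<Rightarrow> real \<Rightarrow> 'a" where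
  "circle_deriv g \<equiv> \<lambda>s. vector_derivative g (at s)"

text \<open>
  The recursion goes through the first derivative, so that the product rule and the chain rule for
  \<open>exp\<close> lift to all orders by induction on \<open>k\<close> with the functions generalized.
\<close>

primrec differentiable_upto :: "nat \<Rightarrow> (real \<Rightarrow> 'a::real_normed_vector) \<Rightarrow> bool" where
  "differentiable_upto 0 g \<longleftrightarrow> True"
| "differentiable_upto (Suc k) g \<longleftrightarrow>
     (\<forall>t. g differentiable at t) \<and> differentiable_upto k (circle_deriv g)"

lemma differentiable_upto_iff:
  "differentiable_upto k g \<longleftrightarrow> (\<forall>j<k. \<forall>t. (circle_deriv ^^ j) g differentiable at t)"
proof (induction k arbitrary: g)
  case (Suc k)
  have "(\<forall>j<Suc k. \<forall>t. (circle_deriv ^^ j) g differentiable at t) \<longleftrightarrow>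
        (\<forall>t. g differentiable at t) \<and> (\<forall>j<k. \<forall>t. (circle_deriv ^^ Suc j) g differentiable at t)"
    unfolding All_less_Suc2 by simp
  then show ?case
    by (simp add: Suc.IH funpow_Suc_right del: funpow.simps)
qed simp

lemma smooth_circle_iff:
  "g \<in> smooth_circle \<longleftrightarrow> (\<forall>k. differentiable_upto k g) \<and> (\<forall>t. g (t + 2 * pi) = g t)"
  unfolding smooth_circle_def differentiable_upto_iff by blast

lemma smooth_circle_periodic: "g \<in> smooth_circle \<Longrightarrow> g (t + 2 * pi) = g t"
  by (simp add: smooth_circle_iff)

lemma smooth_circle_derivative:
  assumes "g \<in> smooth_circle"
  shows "(g has_vector_derivative circle_deriv g t) (at t)"
proof -
  have "differentiable_upto 1 g"
    using assms smooth_circle_iff by blast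
  then show ?thesis
    by (simp add: vector_derivative_works)
qed

lemma smooth_circle_continuous:
  "g \<in> smooth_circle \<Longrightarrow> continuous_on S g"
  by (meson continuous_at_imp_continuous_on has_vector_derivative_continuous smooth_circle_derivative)

lemma vector_derivative_periodic:
  assumes "\<And>t. g (t + p) = g t"
  shows "circle_deriv g (t + p) = circle_deriv g t"
proof -
  have "(g has_vector_derivative D) (at (t + p)) \<longleftrightarrow> (g has_vector_derivative D) (at t)" for D
  proof
    assume "(g has_vector_derivative D) (at (t + p))"
    then have "(g \<circ> (\<lambda>s. s + p) has_vector_derivative 1 *\<^sub>R D) (at t)"
      by (intro vector_diff_chain_at) (auto intro!: derivative_eq_intros)
    then show "(g has_vector_derivative D) (at t)"
      by (simp add: o_def assms)
  next
    assume "(g has_vector_derivative D) (at t)"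
    then have "(g \<circ> (\<lambda>s. s - p) has_vector_derivative 1 *\<^sub>R D) (at (t + p))"
      by (intro vector_diff_chain_at) (auto intro!: derivative_eq_intros)
    moreover have "g (s - p) = g s" for s
      using assms[of "s - p"] by simp
    ultimately show "(g has_vector_derivative D) (at (t + p))"
      by (simp add: o_def)
  qed
  then show ?thesis
    by (simp add: vector_derivative_def)
qed

lemma smooth_circle_deriv:
  assumes "g \<in> smooth_circle"
  shows "circle_deriv g \<in> smooth_circle"
proof -
  have "differentiable_upto (Suc k) g" for k
    using assms smooth_circle_iff by blast
  then show ?thesis
    using assms by (auto simp: smooth_circle_iff intro!: vector_derivative_periodic)
qed

lemma smooth_circle_bounded:
  fixes g :: "real \<Rightarrow> 'a::real_normed_vector"
  assumes "g \<in> smooth_circle"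
  obtains C where "C \<ge> 0" "\<And>t. norm (g t) \<le> C"
proof -
  have "compact (g ` {0..2 * pi})"
    by (intro compact_continuous_image smooth_circle_continuous assms compact_Icc)
  then obtain C where C: "\<And>t. t \<in> {0..2 * pi} \<Longrightarrow> norm (g t) \<le> C"
    by (metis bounded_iff compact_imp_bounded imageI)
  have "norm (g t) \<le> C" for t
  proof -
    have per: "g (s + of_int k * (2 * pi)) = g s" for s k
    proof (induction k rule: int_induct[where k = 0])
      case (step1 i)
      have "g (s + of_int i * (2 * pi) + 2 * pi) = g (s + of_int i * (2 * pi))"
        using assms by (simp add: smooth_circle_def)
      with step1 show ?case
        by (simp add: algebra_simps)
    next
      case (step2 i)
      have "g (s + of_int (i - 1) * (2 * pi) + 2 * pi) = g (s + of_int (i - 1) * (2 * pi))"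
        using assms by (simp add: smooth_circle_def)
      with step2 show ?case
        by (simp add: algebra_simps)
    qed simp
    \<comment> \<open>\<open>k\<close> periods are removed to move \<open>t\<close> into the fundamental interval, where \<open>C\<close> is a bound.\<close>
    define k where "k = \<lfloor>t / (2 * pi)\<rfloor>"
    have "of_int k \<le> t / (2 * pi)" "t / (2 * pi) \<le> of_int k + 1"
      unfolding k_def by linarith+
    then have "t + of_int (- k) * (2 * pi) \<in> {0..2 * pi}"
      by (simp add: field_simps)
    then show ?thesis
      using C per[of t "- k"] by metis
  qed
  moreover have "C \<ge> 0"
    using C[of 0] norm_ge_zero[of "g 0"] by (simp del: norm_ge_zero)
  ultimately show ?thesis
    using that by blast
qed

lemma differentiable_upto_mono: "differentiable_upto (Suc k) g \<Longrightarrow> differentiable_upto k g"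
  by (auto simp: differentiable_upto_iff)

lemma circle_deriv_eqI:
  "(\<And>t. (g has_vector_derivative g' t) (at t)) \<Longrightarrow> circle_deriv g = g'"
  by (auto simp: vector_derivative_at)

lemma differentiable_uptoI:
  assumes "\<And>t. (g has_vector_derivative g' t) (at t)" and "differentiable_upto k g'"
  shows "differentiable_upto (Suc k) g"
  using assms circle_deriv_eqI[of g g'] by (auto intro: differentiableI_vector)

lemma differentiable_upto_add:
  "differentiable_upto k g \<Longrightarrow> differentiable_upto k h \<Longrightarrow> differentiable_upto k (\<lambda>t. g t + h t)"
proof (induction k arbitrary: g h)
  case (Suc k)
  show ?case
  proof (rule differentiable_uptoI)
    show "((\<lambda>t. g t + h t) has_vector_derivative circle_deriv g t + circle_deriv h t) (at t)" for t
      using Suc.prems by (auto intro!: has_vector_derivative_add simp: vector_derivative_works)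
  qed (use Suc in auto)
qed simp

lemma differentiable_upto_mult:
  fixes g h :: "real \<Rightarrow> 'a::real_normed_algebra"
  shows "differentiable_upto k g \<Longrightarrow> differentiable_upto k h \<Longrightarrow> differentiable_upto k (\<lambda>t. g t * h t)"
proof (induction k arbitrary: g h)
  case (Suc k)
  show ?case
  proof (rule differentiable_uptoI)
    show "((\<lambda>t. g t * h t) has_vector_derivative g t * circle_deriv h t + circle_deriv g t * h t)
            (at t)" for t
      using Suc.prems by (auto intro!: has_vector_derivative_mult simp: vector_derivative_works)
    show "differentiable_upto k (\<lambda>t. g t * circle_deriv h t + circle_deriv g t * h t)"
      using Suc differentiable_upto_mono[OF Suc.prems(1)] differentiable_upto_mono[OF Suc.prems(2)]
      by (auto intro!: differentiable_upto_add)
  qed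
qed simp

lemma differentiable_upto_const: "differentiable_upto k (\<lambda>t. c)"
proof (induction k arbitrary: c)
  case (Suc k)
  show ?case
    by (rule differentiable_uptoI[where g' = "\<lambda>t. 0"]) (auto simp: Suc)
qed simp

lemma differentiable_upto_exp:
  fixes g :: "real \<Rightarrow> complex"
  shows "differentiable_upto k g \<Longrightarrow> differentiable_upto k (\<lambda>t. exp (g t))"
proof (induction k arbitrary: g)
  case (Suc k)
  show ?case
  proof (rule differentiable_uptoI)
    show "((\<lambda>t. exp (g t)) has_vector_derivative circle_deriv g t * exp (g t)) (at t)" for t
    proof -
      have "(g has_vector_derivative circle_deriv g t) (at t)"
        using Suc.prems by (simp add: vector_derivative_works)
      from field_vector_diff_chain_at[OF this, of exp "exp (g t)"] show ?thesis
        by (simp add: o_def DERIV_exp)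
    qed
    show "differentiable_upto k (\<lambda>t. circle_deriv g t * exp (g t))"
      using Suc differentiable_upto_mono[OF Suc.prems] by (auto intro!: differentiable_upto_mult)
  qed
qed simp

lemma differentiable_upto_of_real:
  fixes g :: "real \<Rightarrow> real"
  shows "differentiable_upto k g \<Longrightarrow> differentiable_upto k (\<lambda>t. complex_of_real (g t))"
proof (induction k arbitrary: g)
  case (Suc k)
  show ?case
  proof (rule differentiable_uptoI)
    show "((\<lambda>t. complex_of_real (g t)) has_vector_derivative complex_of_real (circle_deriv g t)) (at t)"
      for t
      using Suc.prems by (auto intro!: has_vector_derivative_of_real
          simp: vector_derivative_works has_real_derivative_iff_has_vector_derivative)
  qed (use Suc in auto)
qed simp

lemma smooth_circle_add:
  "g \<in> smooth_circle \<Longrightarrow> h \<in> smooth_circle \<Longrightarrow> (\<lambda>t. g t + h t) \<in> smooth_circle"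
  by (simp add: smooth_circle_iff differentiable_upto_add)

lemma smooth_circle_mult:
  fixes g h :: "real \<Rightarrow> 'a::real_normed_algebra"
  shows "g \<in> smooth_circle \<Longrightarrow> h \<in> smooth_circle \<Longrightarrow> (\<lambda>t. g t * h t) \<in> smooth_circle"
  by (simp add: smooth_circle_iff differentiable_upto_mult)

lemma smooth_circle_const: "(\<lambda>t. c) \<in> smooth_circle"
  by (simp add: smooth_circle_iff differentiable_upto_const)

lemma smooth_circle_exp:
  fixes g :: "real \<Rightarrow> complex"
  shows "g \<in> smooth_circle \<Longrightarrow> (\<lambda>t. exp (g t)) \<in> smooth_circle"
  by (simp add: smooth_circle_iff differentiable_upto_exp)

lemma smooth_circle_of_real:
  "g \<in> smooth_circle \<Longrightarrow> (\<lambda>t. complex_of_real (g t)) \<in> smooth_circle"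
  by (simp add: smooth_circle_iff differentiable_upto_of_real)

lemma smooth_circle_uminus:
  fixes g :: "real \<Rightarrow> 'a::real_normed_algebra_1"
  shows "g \<in> smooth_circle \<Longrightarrow> (\<lambda>t. - g t) \<in> smooth_circle"
  using smooth_circle_mult[OF smooth_circle_const[of "-1"], of g] by simp

lemma mean_free_primitive_derivative:
  fixes g :: "real \<Rightarrow> 'a::euclidean_space"
  assumes "g \<in> smooth_circle"
  shows "(mean_free_primitive g has_vector_derivative g t - circle_mean g) (at t)"
proof -
  \<comment> \<open>an interval around \<open>0\<close> and \<open>t\<close> that has \<open>t\<close> in its interior\<close>
  let ?l = "min 0 t - 1" and ?u = "max 0 t + 1"
  have "((\<lambda>u. LBINT y=0..u. g y) has_vector_derivative g t) (at t within {?l..?u})"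
    unfolding zero_ereal_def by (rule interval_integral_FTC2) (auto intro: smooth_circle_continuous assms)
  then have "((\<lambda>u. LBINT y=0..u. g y) has_vector_derivative g t) (at t within {?l<..<?u})"
    by (rule has_vector_derivative_within_subset) auto
  then have "((\<lambda>u. LBINT y=0..u. g y) has_vector_derivative g t) (at t)"
    by (subst (asm) has_vector_derivative_within_open) auto
  moreover have "((\<lambda>t. t *\<^sub>R circle_mean g) has_vector_derivative circle_mean g) (at t)"
    by (auto intro!: derivative_eq_intros)
  ultimately show ?thesis
    unfolding mean_free_primitive_def[abs_def] by (rule has_vector_derivative_diff)
qed

text \<open>
  The difference \<open>G (t + 2 * pi) - G t\<close> is constant because \<open>g\<close> is periodic, and at \<open>t = 0\<close> it is the
  integral of \<open>g\<close> over a period minus \<open>2 * pi\<close> times its mean.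
\<close>

lemma mean_free_primitive_periodic:
  fixes g :: "real \<Rightarrow> 'a::euclidean_space"
  assumes "g \<in> smooth_circle"
  shows "mean_free_primitive g (t + 2 * pi) = mean_free_primitive g t"
proof -
  let ?G = "mean_free_primitive g"
  have "((\<lambda>t. ?G (t + 2 * pi) - ?G t) has_vector_derivative 0) (at t within UNIV)" for t
  proof -
    have "(?G \<circ> (\<lambda>t. t + 2 * pi) has_vector_derivative 1 *\<^sub>R (g (t + 2 * pi) - circle_mean g)) (at t)"
      by (intro vector_diff_chain_at mean_free_primitive_derivative assms)
         (auto intro!: derivative_eq_intros)
    moreover have "g (t + 2 * pi) = g t"
      using assms by (simp add: smooth_circle_def)
    ultimately have "((\<lambda>t. ?G (t + 2 * pi)) has_vector_derivative g t - circle_mean g) (at t)"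
      by (simp add: o_def)
    from has_vector_derivative_diff[OF this mean_free_primitive_derivative[OF assms, of t]]
    show ?thesis by simp
  qed
  then obtain c where c: "\<And>t. ?G (t + 2 * pi) - ?G t = c"
    by (rule has_vector_derivative_zero_constant[OF convex_UNIV]) auto
  moreover have "?G (0 + 2 * pi) - ?G 0 = 0"
    unfolding mean_free_primitive_def circle_mean_def
    by (simp flip: zero_ereal_def)
  ultimately show ?thesis
    by (metis eq_iff_diff_eq_0)
qed

lemma smooth_circle_mean_free_primitive:
  fixes g :: "real \<Rightarrow> 'a::euclidean_space"
  assumes "g \<in> smooth_circle"
  shows "mean_free_primitive g \<in> smooth_circle"
  unfolding smooth_circle_iff
proof (intro conjI allI)
  fix k :: nat
  have "differentiable_upto (Suc k) (mean_free_primitive g)"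
  proof (rule differentiable_uptoI[OF mean_free_primitive_derivative[OF assms]])
    show "differentiable_upto k (\<lambda>t. g t - circle_mean g)"
      using assms differentiable_upto_add[OF _ differentiable_upto_const, of k g "- circle_mean g"]
      by (simp add: smooth_circle_iff)
  qed
  then show "differentiable_upto k (mean_free_primitive g)"
    by (rule differentiable_upto_mono)
qed (rule mean_free_primitive_periodic[OF assms])

section \<open>Calculus of smooth functions on the cylinder\<close>

lemma smooth_cylinder_C_k: "f \<in> smooth_cylinder \<Longrightarrow> C_k k f"
  by (simp add: smooth_cylinder_def)

lemma smooth_cylinder_continuous: "f \<in> smooth_cylinder \<Longrightarrow> continuous_on S (\<lambda>(t, x). f t x)"
  using smooth_cylinder_C_k[of f 0] continuous_on_subset[of UNIV _ S] by simp

lemma smooth_cylinder_has_D_t: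
  "f \<in> smooth_cylinder \<Longrightarrow> ((\<lambda>s. f s x) has_vector_derivative D_t f t x) (at t)"
  using smooth_cylinder_C_k[of f 1] by (simp add: D_t_def vector_derivative_works)

lemma smooth_cylinder_has_D_x:
  "f \<in> smooth_cylinder \<Longrightarrow> ((\<lambda>y. f t y) has_vector_derivative D_x f t x) (at x)"
  using smooth_cylinder_C_k[of f 1] by (simp add: D_x_def vector_derivative_works)

lemma smooth_cylinder_D_t:
  assumes "f \<in> smooth_cylinder"
  shows "D_t f \<in> smooth_cylinder"
proof -
  have "C_k k (D_t f)" for k
    using smooth_cylinder_C_k[OF assms, of "Suc k"] by simp
  moreover have "D_t f (t + 2 * pi) x = D_t f t x" for t x
    using assms unfolding D_t_def by (intro vector_derivative_periodic) (simp add: smooth_cylinder_def)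
  ultimately show ?thesis
    by (simp add: smooth_cylinder_def)
qed

lemma smooth_cylinder_D_x:
  assumes "f \<in> smooth_cylinder"
  shows "D_x f \<in> smooth_cylinder"
proof -
  have "C_k k (D_x f)" for k
    using smooth_cylinder_C_k[OF assms, of "Suc k"] by simp
  moreover have "f (t + 2 * pi) = f t" for t
    using assms by (auto simp: smooth_cylinder_def)
  ultimately show ?thesis
    by (simp add: smooth_cylinder_def D_x_def)
qed

lemma smooth_cylinder_continuous_compose:
  assumes "f \<in> smooth_cylinder" "continuous_on S u" "continuous_on S v"
  shows "continuous_on S (\<lambda>p. f (u p) (v p))"
  using continuous_on_compose2[OF smooth_cylinder_continuous[OF assms(1), of UNIV]
      continuous_on_Pair[OF assms(2,3)]] by simp

text \<open>
  Smoothness on the cylinder is phrased through partial derivatives only; their joint continuity gives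
  the total derivative, and with it the chain rule along curves.
\<close>

lemma smooth_cylinder_has_derivative:
  assumes "f \<in> smooth_cylinder"
  shows "((\<lambda>(t, x). f t x) has_derivative (\<lambda>(h, k). h *\<^sub>R D_t f t x + k *\<^sub>R D_x f t x)) (at (t, x))"
proof -
  have "((\<lambda>(t, x). f t x) has_derivative
          (\<lambda>(h, k). h *\<^sub>R D_t f t x + blinfun_scaleR_left (D_x f t x) k)) (at (t, x) within UNIV \<times> UNIV)"
  proof (rule has_derivative_partialsI)
    show "((\<lambda>s. f s x) has_derivative (\<lambda>h. h *\<^sub>R D_t f t x)) (at t within UNIV)"
      using smooth_cylinder_has_D_t[OF assms] by (simp add: has_vector_derivative_def)
    show "((\<lambda>y. f t y) has_derivative blinfun_scaleR_left (D_x f t x)) (at x within UNIV)" for t x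
      using smooth_cylinder_has_D_x[OF assms] by (simp add: has_vector_derivative_def)
    have "continuous_on UNIV (\<lambda>(t, x). blinfun_scaleR_left (D_x f t x))"
      unfolding case_prod_unfold
      by (intro continuous_intros smooth_cylinder_continuous_compose smooth_cylinder_D_x assms)
    then show "continuous (at (t, x) within UNIV \<times> UNIV) (\<lambda>(t, x). blinfun_scaleR_left (D_x f t x))"
      by (simp add: continuous_on_eq_continuous_within)
  qed auto
  then show ?thesis
    by simp
qed

lemma smooth_cylinder_chain_rule:
  assumes "f \<in> smooth_cylinder" and "(g has_vector_derivative g') (at t)"
  shows "((\<lambda>s. f s (g s)) has_vector_derivative D_t f t (g t) + g' *\<^sub>R D_x f t (g t)) (at t)"
proof -
  have "((\<lambda>s. (s, g s)) has_derivative (\<lambda>h. (h, h *\<^sub>R g'))) (at t)"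
    using assms(2) by (auto intro!: derivative_eq_intros simp: has_vector_derivative_def)
  from has_derivative_compose[OF this smooth_cylinder_has_derivative[OF assms(1), of t "g t"]]
  show ?thesis
    by (simp add: has_vector_derivative_def algebra_simps)
qed

text \<open>
  Differentiating \<open>f t y = f t l + \<integral>\<^sub>l\<^sup>y D_x f t z dz\<close> in \<open>t\<close> under the integral sign exhibits \<open>D_t f t\<close>, up
  to a constant, as an antiderivative of \<open>D_t (D_x f) t\<close>.
\<close>

lemma D_x_D_t_commute:
  assumes f: "f \<in> smooth_cylinder"
  shows "D_x (D_t f) = D_t (D_x f)"
proof (intro ext)
  fix t x :: real
  \<comment> \<open>any base point to the left of \<open>x\<close> works; \<open>x\<close> then lies inside \<open>{l<..<x + 1}\<close>\<close>
  define l where "l = x - 1"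
  have Dxf: "D_x f \<in> smooth_cylinder" and Dtx: "D_t (D_x f) \<in> smooth_cylinder"
    using f by (auto intro: smooth_cylinder_D_t smooth_cylinder_D_x)
  have cont: "continuous_on S (D_x f s)" "continuous_on S (D_t (D_x f) s)" for s S
    by (auto intro!: smooth_cylinder_continuous_compose[OF Dxf, of _ "\<lambda>_. s" "\<lambda>y. y", simplified]
        smooth_cylinder_continuous_compose[OF Dtx, of _ "\<lambda>_. s" "\<lambda>y. y", simplified])
  have ftc: "integral {l..y} (D_x f s) = f s y - f s l" if "l \<le> y" for s y
    by (intro integral_unique fundamental_theorem_of_calculus that)
       (auto intro: has_vector_derivative_at_within smooth_cylinder_has_D_x[OF f])
  have leibniz: "D_t f t y = D_t f t l + integral {l..y} (D_t (D_x f) t)" if "l \<le> y" for y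
  proof -
    have "((\<lambda>s. integral (cbox l y) (D_x f s)) has_vector_derivative
            integral (cbox l y) (D_t (D_x f) t)) (at t within UNIV)"
    proof (rule leibniz_rule_vector_derivative)
      show "((\<lambda>s. D_x f s z) has_vector_derivative D_t (D_x f) s z) (at s within UNIV)" for s z
        using smooth_cylinder_has_D_t[OF Dxf] by simp
      show "continuous_on (UNIV \<times> cbox l y) (\<lambda>(s, z). D_t (D_x f) s z)"
        by (rule smooth_cylinder_continuous[OF Dtx])
    qed (auto intro!: integrable_continuous_interval cont)
    then have "((\<lambda>s. f s y - f s l) has_vector_derivative integral {l..y} (D_t (D_x f) t)) (at t)"
      by (simp add: ftc that)
    moreover have "((\<lambda>s. f s y - f s l) has_vector_derivative D_t f t y - D_t f t l) (at t)"
      by (intro has_vector_derivative_diff smooth_cylinder_has_D_t f)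
    ultimately show ?thesis
      using vector_derivative_unique_at by fastforce
  qed
  have "((\<lambda>y. integral {l..y} (D_t (D_x f) t)) has_vector_derivative D_t (D_x f) t x)
          (at x within {l..x + 1})"
    by (rule integral_has_vector_derivative) (auto simp: l_def intro: cont)
  then have "((\<lambda>y. D_t f t l + integral {l..y} (D_t (D_x f) t)) has_vector_derivative D_t (D_x f) t x)
          (at x within {l..x + 1})"
    by (auto intro!: derivative_eq_intros)
  then have "(D_t f t has_vector_derivative D_t (D_x f) t x) (at x within {l..x + 1})"
    by (rule has_vector_derivative_transform[rotated 2]) (simp add: l_def, rule leibniz, simp)
  then have "(D_t f t has_vector_derivative D_t (D_x f) t x) (at x within {l<..<x + 1})"
    by (rule has_vector_derivative_within_subset) auto
  then have "(D_t f t has_vector_derivative D_t (D_x f) t x) (at x)"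
    by (subst (asm) has_vector_derivative_within_open) (auto simp: l_def)
  then show "D_x (D_t f) t x = D_t (D_x f) t x"
    by (simp add: D_x_def vector_derivative_at)
qed

lemma smooth_cylinder_funpow_D_t: "f \<in> smooth_cylinder \<Longrightarrow> (D_t ^^ n) f \<in> smooth_cylinder"
  by (induction n) (auto intro: smooth_cylinder_D_t)

lemma smooth_cylinder_funpow_D_x: "f \<in> smooth_cylinder \<Longrightarrow> (D_x ^^ n) f \<in> smooth_cylinder"
  by (induction n) (auto intro: smooth_cylinder_D_x)

lemma D_x_funpow_D_t_commute:
  "f \<in> smooth_cylinder \<Longrightarrow> D_x ((D_t ^^ n) f) = (D_t ^^ n) (D_x f)"
  by (induction n) (auto simp: D_x_D_t_commute smooth_cylinder_funpow_D_t)

lemma D_t_add: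
  assumes "f \<in> smooth_cylinder" "g \<in> smooth_cylinder"
  shows "D_t (\<lambda>t x. f t x + g t x) = (\<lambda>t x. D_t f t x + D_t g t x)"
  unfolding D_t_def[of "\<lambda>t x. f t x + g t x"]
  using has_vector_derivative_add[OF smooth_cylinder_has_D_t[OF assms(1)] smooth_cylinder_has_D_t[OF assms(2)]]
  by (auto intro!: ext vector_derivative_at)

lemma D_x_add:
  assumes "f \<in> smooth_cylinder" "g \<in> smooth_cylinder"
  shows "D_x (\<lambda>t x. f t x + g t x) = (\<lambda>t x. D_x f t x + D_x g t x)"
  unfolding D_x_def[of "\<lambda>t x. f t x + g t x"]
  using has_vector_derivative_add[OF smooth_cylinder_has_D_x[OF assms(1)] smooth_cylinder_has_D_x[OF assms(2)]]
  by (auto intro!: ext vector_derivative_at)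

lemma D_t_scale:
  assumes "f \<in> smooth_cylinder"
  shows "D_t (\<lambda>t x. c * f t x) = (\<lambda>t x. c * D_t f t x)"
  unfolding D_t_def[of "\<lambda>t x. c * f t x"]
  using has_vector_derivative_mult_right[OF smooth_cylinder_has_D_t[OF assms]]
  by (auto intro!: ext vector_derivative_at)

lemma D_x_scale:
  assumes "f \<in> smooth_cylinder"
  shows "D_x (\<lambda>t x. c * f t x) = (\<lambda>t x. c * D_x f t x)"
  unfolding D_x_def[of "\<lambda>t x. c * f t x"]
  using has_vector_derivative_mult_right[OF smooth_cylinder_has_D_x[OF assms]]
  by (auto intro!: ext vector_derivative_at)

lemma smooth_cylinder_add:
  assumes "f \<in> smooth_cylinder" "g \<in> smooth_cylinder"
  shows "(\<lambda>t x. f t x + g t x) \<in> smooth_cylinder"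
proof -
  have "C_k k (\<lambda>t x. f t x + g t x)" for k
    using assms
  proof (induction k arbitrary: f g)
    case 0
    then show ?case
      by (auto simp: case_prod_unfold intro!: continuous_intros smooth_cylinder_continuous_compose)
  next
    case (Suc k)
    note D = smooth_cylinder_has_D_t[OF Suc.prems(1)] smooth_cylinder_has_D_t[OF Suc.prems(2)]
      smooth_cylinder_has_D_x[OF Suc.prems(1)] smooth_cylinder_has_D_x[OF Suc.prems(2)]
    have "(\<lambda>s. f s x + g s x) differentiable at t" "(\<lambda>y. f t y + g t y) differentiable at x" for t x
      using has_vector_derivative_add[OF D(1,2)] has_vector_derivative_add[OF D(3,4)]
      by (blast intro: differentiableI_vector)+
    with Suc show ?case
      by (simp add: D_t_add D_x_add smooth_cylinder_D_t smooth_cylinder_D_x)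
  qed
  then show ?thesis
    using assms by (simp add: smooth_cylinder_def)
qed

lemma smooth_cylinder_scale:
  assumes "f \<in> smooth_cylinder"
  shows "(\<lambda>t x. c * f t x) \<in> smooth_cylinder"
proof -
  have "C_k k (\<lambda>t x. c * f t x)" for k
    using assms
  proof (induction k arbitrary: f)
    case 0
    then show ?case
      by (auto simp: case_prod_unfold intro!: continuous_intros smooth_cylinder_continuous_compose)
  next
    case (Suc k)
    note D = smooth_cylinder_has_D_t[OF Suc.prems] smooth_cylinder_has_D_x[OF Suc.prems]
    have "(\<lambda>s. c * f s x) differentiable at t" "(\<lambda>y. c * f t y) differentiable at x" for t x
      using has_vector_derivative_mult_right[OF D(1)] has_vector_derivative_mult_right[OF D(2)]
      by (blast intro: differentiableI_vector)+
    with Suc show ?case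
      by (simp add: D_t_scale D_x_scale smooth_cylinder_D_t smooth_cylinder_D_x)
  qed
  then show ?thesis
    using assms by (simp add: smooth_cylinder_def)
qed

lemma funpow_D_add:
  assumes "f \<in> smooth_cylinder" "g \<in> smooth_cylinder"
  shows "(D_t ^^ \<alpha>) ((D_x ^^ \<beta>) (\<lambda>t x. f t x + g t x)) =
    (\<lambda>t x. (D_t ^^ \<alpha>) ((D_x ^^ \<beta>) f) t x + (D_t ^^ \<alpha>) ((D_x ^^ \<beta>) g) t x)"
proof -
  have "(D_x ^^ \<beta>) (\<lambda>t x. f t x + g t x) = (\<lambda>t x. (D_x ^^ \<beta>) f t x + (D_x ^^ \<beta>) g t x)"
    using assms by (induction \<beta>) (auto simp: D_x_add smooth_cylinder_funpow_D_x)
  then show ?thesis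
    using assms
    by (induction \<alpha>) (auto simp: D_t_add smooth_cylinder_funpow_D_x smooth_cylinder_funpow_D_t)
qed

lemma funpow_D_scale:
  assumes "f \<in> smooth_cylinder"
  shows "(D_t ^^ \<alpha>) ((D_x ^^ \<beta>) (\<lambda>t x. c * f t x)) = (\<lambda>t x. c * (D_t ^^ \<alpha>) ((D_x ^^ \<beta>) f) t x)"
proof -
  have "(D_x ^^ \<beta>) (\<lambda>t x. c * f t x) = (\<lambda>t x. c * (D_x ^^ \<beta>) f t x)"
    using assms by (induction \<beta>) (auto simp: D_x_scale smooth_cylinder_funpow_D_x)
  then show ?thesis
    using assms
    by (induction \<alpha>) (auto simp: D_t_scale smooth_cylinder_funpow_D_x smooth_cylinder_funpow_D_t)
qed

section \<open>Schwartz functions and their seminorms\<close>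

lemma schwartz_smooth: "f \<in> schwartz \<Longrightarrow> f \<in> smooth_cylinder"
  by (simp add: schwartz_def)

lemma weighted_deriv_nonneg: "weighted_deriv \<alpha> \<beta> \<gamma> f p \<ge> 0"
  by (simp add: weighted_deriv_def case_prod_unfold)

lemma weighted_deriv_add:
  assumes "f \<in> smooth_cylinder" "g \<in> smooth_cylinder"
  shows "weighted_deriv \<alpha> \<beta> \<gamma> (\<lambda>t x. f t x + g t x) p \<le>
    weighted_deriv \<alpha> \<beta> \<gamma> f p + weighted_deriv \<alpha> \<beta> \<gamma> g p"
  unfolding weighted_deriv_def case_prod_unfold funpow_D_add[OF assms]
  by (simp add: distrib_left norm_triangle_ineq)

lemma weighted_deriv_scale:
  assumes "f \<in> smooth_cylinder"
  shows "weighted_deriv \<alpha> \<beta> \<gamma> (\<lambda>t x. c * f t x) p = norm c * weighted_deriv \<alpha> \<beta> \<gamma> f p"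
  unfolding weighted_deriv_def case_prod_unfold funpow_D_scale[OF assms]
  by (simp add: norm_mult)

lemma schwartzI:
  assumes "f \<in> smooth_cylinder" and "\<And>\<alpha> \<beta> \<gamma>. \<exists>C. \<forall>p. weighted_deriv \<alpha> \<beta> \<gamma> f p \<le> C"
  shows "f \<in> schwartz"
  using assms unfolding schwartz_def bdd_above_def by auto

lemma weighted_deriv_le_schwartz_norm:
  "f \<in> schwartz \<Longrightarrow> weighted_deriv \<alpha> \<beta> \<gamma> f p \<le> schwartz_norm \<alpha> \<beta> \<gamma> f"
  unfolding schwartz_norm_def by (rule cSup_upper) (auto simp: schwartz_def)

lemma schwartz_norm_leI:
  "(\<And>p. weighted_deriv \<alpha> \<beta> \<gamma> f p \<le> C) \<Longrightarrow> schwartz_norm \<alpha> \<beta> \<gamma> f \<le> C"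
  unfolding schwartz_norm_def by (rule cSup_least) auto

lemma schwartz_norm_nonneg: "f \<in> schwartz \<Longrightarrow> schwartz_norm \<alpha> \<beta> \<gamma> f \<ge> 0"
  using weighted_deriv_le_schwartz_norm weighted_deriv_nonneg order_trans by meson

lemma finite_seminorm_index: "finite {(\<alpha>, \<beta>, \<gamma>). \<alpha> + \<beta> + \<gamma> \<le> (N::nat)}"
  by (rule finite_subset[of _ "{..N} \<times> {..N} \<times> {..N}"]) auto

lemma schwartz_norm_le_seminorm:
  assumes "f \<in> schwartz" and "\<alpha> + \<beta> + \<gamma> \<le> N"
  shows "schwartz_norm \<alpha> \<beta> \<gamma> f \<le> schwartz_seminorm N f"
proof -
  have "(case (\<alpha>, \<beta>, \<gamma>) of (\<alpha>, \<beta>, \<gamma>) \<Rightarrow> schwartz_norm \<alpha> \<beta> \<gamma> f) \<le> schwartz_seminorm N f"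
    unfolding schwartz_seminorm_def
    by (rule member_le_sum[OF _ _ finite_seminorm_index])
       (use assms in \<open>auto simp: schwartz_norm_nonneg\<close>)
  then show ?thesis by simp
qed

lemma schwartz_seminorm_nonneg: "f \<in> schwartz \<Longrightarrow> schwartz_seminorm N f \<ge> 0"
  unfolding schwartz_seminorm_def by (intro sum_nonneg) (auto simp: schwartz_norm_nonneg)

lemma schwartz_seminorm_mono:
  "f \<in> schwartz \<Longrightarrow> M \<le> N \<Longrightarrow> schwartz_seminorm M f \<le> schwartz_seminorm N f"
  unfolding schwartz_seminorm_def
  by (intro sum_mono2) (auto simp: finite_seminorm_index schwartz_norm_nonneg)

lemma schwartz_add:
  assumes "f \<in> schwartz" "g \<in> schwartz"
  shows "(\<lambda>t x. f t x + g t x) \<in> schwartz"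
proof (rule schwartzI)
  fix \<alpha> \<beta> \<gamma>
  show "\<exists>C. \<forall>p. weighted_deriv \<alpha> \<beta> \<gamma> (\<lambda>t x. f t x + g t x) p \<le> C"
    using order_trans[OF weighted_deriv_add[OF assms[THEN schwartz_smooth]]
        add_mono[OF weighted_deriv_le_schwartz_norm[OF assms(1)]
          weighted_deriv_le_schwartz_norm[OF assms(2)]]] by blast
qed (use assms in \<open>auto intro: smooth_cylinder_add schwartz_smooth\<close>)

lemma schwartz_scale:
  assumes "f \<in> schwartz"
  shows "(\<lambda>t x. c * f t x) \<in> schwartz"
proof (rule schwartzI)
  fix \<alpha> \<beta> \<gamma>
  show "\<exists>C. \<forall>p. weighted_deriv \<alpha> \<beta> \<gamma> (\<lambda>t x. c * f t x) p \<le> C"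
    unfolding weighted_deriv_scale[OF schwartz_smooth[OF assms]]
    using mult_left_mono[OF weighted_deriv_le_schwartz_norm[OF assms] norm_ge_zero[of c]] by blast
qed (use assms in \<open>auto intro: smooth_cylinder_scale schwartz_smooth\<close>)

lemma schwartz_uminus: "f \<in> schwartz \<Longrightarrow> (\<lambda>t x. - f t x) \<in> schwartz"
  using schwartz_scale[of f "-1"] by simp

lemma schwartz_diff:
  "f \<in> schwartz \<Longrightarrow> g \<in> schwartz \<Longrightarrow> (\<lambda>t x. f t x - g t x) \<in> schwartz"
  using schwartz_add[of f "\<lambda>t x. - g t x"] schwartz_uminus[of g] by simp

lemma schwartz_seminorm_triangle:
  assumes "f \<in> schwartz" "g \<in> schwartz"
  shows "schwartz_seminorm N (\<lambda>t x. f t x + g t x) \<le> schwartz_seminorm N f + schwartz_seminorm N g"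
proof -
  have "schwartz_norm \<alpha> \<beta> \<gamma> (\<lambda>t x. f t x + g t x) \<le> schwartz_norm \<alpha> \<beta> \<gamma> f + schwartz_norm \<alpha> \<beta> \<gamma> g"
    for \<alpha> \<beta> \<gamma>
    by (intro schwartz_norm_leI order_trans[OF weighted_deriv_add] add_mono
        weighted_deriv_le_schwartz_norm schwartz_smooth assms)
  then show ?thesis
    unfolding schwartz_seminorm_def sum.distrib[symmetric] by (intro sum_mono) auto
qed

lemma schwartz_continuous: "f \<in> schwartz \<Longrightarrow> continuous_on UNIV (\<lambda>(t, x). f t x)"
  by (intro smooth_cylinder_continuous schwartz_smooth)

lemma schwartz_periodic: "f \<in> schwartz \<Longrightarrow> f (t + 2 * pi) x = f t x"
  by (simp add: schwartz_def smooth_cylinder_def)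

lemma schwartz_has_D_t: "f \<in> schwartz \<Longrightarrow> ((\<lambda>s. f s x) has_vector_derivative D_t f t x) (at t)"
  by (intro smooth_cylinder_has_D_t schwartz_smooth)

lemma schwartz_has_D_x: "f \<in> schwartz \<Longrightarrow> (f t has_vector_derivative D_x f t x) (at x)"
  by (intro smooth_cylinder_has_D_x schwartz_smooth)

section \<open>Bounded operators on the Schwartz space\<close>

text \<open>
  Continuity in the form of seminorm estimates, separated from linearity. Each weighted supremum is
  estimated on its own; the estimates for the sums \<open>schwartz_seminorm N\<close> follow.
\<close>

definition bounded_op :: "(cylfun \<Rightarrow> cylfun) \<Rightarrow> bool" where
  "bounded_op T \<longleftrightarrow> (\<forall>f\<in>schwartz. T f \<in> schwartz) \<and>
     (\<forall>\<alpha> \<beta> \<gamma>. \<exists>M C. \<forall>f\<in>schwartz. \<forall>p. weighted_deriv \<alpha> \<beta> \<gamma> (T f) p \<le> C * schwartz_seminorm M f)"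

lemma bounded_op_schwartz: "bounded_op T \<Longrightarrow> f \<in> schwartz \<Longrightarrow> T f \<in> schwartz"
  by (simp add: bounded_op_def)

text \<open>
  Constants in the estimates may be negative, and the seminorms of different order have to be compared
  with a common one: hence the absolute values and the maximum.
\<close>

lemma seminorm_bound_add:
  assumes "f \<in> schwartz" "u \<le> C * schwartz_seminorm M f" "v \<le> D * schwartz_seminorm N f"
  shows "u + v \<le> (\<bar>C\<bar> + \<bar>D\<bar>) * schwartz_seminorm (max M N) f"
proof -
  have "C * schwartz_seminorm M f \<le> \<bar>C\<bar> * schwartz_seminorm (max M N) f"
       "D * schwartz_seminorm N f \<le> \<bar>D\<bar> * schwartz_seminorm (max M N) f"
    using schwartz_seminorm_mono[OF assms(1), of M "max M N"]
      schwartz_seminorm_mono[OF assms(1), of N "max M N"] schwartz_seminorm_nonneg[OF assms(1)]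
    by (auto intro!: mult_mono)
  then show ?thesis
    using assms by (simp add: distrib_right)
qed

lemma bounded_op_seminorm:
  assumes "bounded_op T"
  shows "\<exists>M C. C \<ge> 0 \<and> (\<forall>f\<in>schwartz. schwartz_seminorm N (T f) \<le> C * schwartz_seminorm M f)"
proof -
  have "\<exists>M C. C \<ge> 0 \<and> (\<forall>f\<in>schwartz. (\<Sum>(\<alpha>, \<beta>, \<gamma>)\<in>I. schwartz_norm \<alpha> \<beta> \<gamma> (T f)) \<le> C * schwartz_seminorm M f)"
    if "finite I" for I
    using that
  proof (induction I)
    case empty
    show ?case by (rule exI[of _ 0], rule exI[of _ 0]) simp
  next
    case (insert i I)
    obtain \<alpha> \<beta> \<gamma> where i: "i = (\<alpha>, \<beta>, \<gamma>)" by (cases i) auto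
    obtain M C where "\<And>f. f \<in> schwartz \<Longrightarrow> schwartz_norm \<alpha> \<beta> \<gamma> (T f) \<le> C * schwartz_seminorm M f"
      using assms unfolding bounded_op_def by (meson schwartz_norm_leI)
    moreover obtain N D where "\<And>f. f \<in> schwartz \<Longrightarrow>
        (\<Sum>(\<alpha>, \<beta>, \<gamma>)\<in>I. schwartz_norm \<alpha> \<beta> \<gamma> (T f)) \<le> D * schwartz_seminorm N f"
      using insert.IH by blast
    ultimately have "\<forall>f\<in>schwartz. schwartz_norm \<alpha> \<beta> \<gamma> (T f) + (\<Sum>(\<alpha>, \<beta>, \<gamma>)\<in>I. schwartz_norm \<alpha> \<beta> \<gamma> (T f))
        \<le> (\<bar>C\<bar> + \<bar>D\<bar>) * schwartz_seminorm (max M N) f"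
      by (meson seminorm_bound_add)
    moreover have "\<bar>C\<bar> + \<bar>D\<bar> \<ge> 0" by simp
    ultimately show ?case
      using insert.hyps
      by (intro exI[of _ "max M N"] exI[of _ "\<bar>C\<bar> + \<bar>D\<bar>"]) (simp add: i)
  qed
  from this[OF finite_seminorm_index[of N]] show ?thesis
    by (simp add: schwartz_seminorm_def)
qed

lemma bounded_op_compose:
  assumes "bounded_op T" "bounded_op U"
  shows "bounded_op (\<lambda>f. T (U f))"
  unfolding bounded_op_def
proof (intro conjI ballI allI)
  fix \<alpha> \<beta> \<gamma>
  obtain M C where MC: "\<And>f p. f \<in> schwartz \<Longrightarrow> weighted_deriv \<alpha> \<beta> \<gamma> (T f) p \<le> C * schwartz_seminorm M f"
    using assms(1) unfolding bounded_op_def by meson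
  obtain N D where ND: "D \<ge> 0" "\<And>f. f \<in> schwartz \<Longrightarrow> schwartz_seminorm M (U f) \<le> D * schwartz_seminorm N f"
    using bounded_op_seminorm[OF assms(2), of M] by blast
  have "weighted_deriv \<alpha> \<beta> \<gamma> (T (U f)) p \<le> (\<bar>C\<bar> * D) * schwartz_seminorm N f" if f: "f \<in> schwartz" for f p
  proof -
    have Uf: "U f \<in> schwartz"
      using assms(2) f by (rule bounded_op_schwartz)
    have "weighted_deriv \<alpha> \<beta> \<gamma> (T (U f)) p \<le> C * schwartz_seminorm M (U f)"
      by (rule MC[OF Uf])
    also have "\<dots> \<le> \<bar>C\<bar> * schwartz_seminorm M (U f)"
      by (intro mult_right_mono schwartz_seminorm_nonneg Uf) auto
    also have "\<dots> \<le> \<bar>C\<bar> * (D * schwartz_seminorm N f)"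
      by (intro mult_left_mono ND f) auto
    finally show ?thesis by simp
  qed
  then show "\<exists>M C. \<forall>f\<in>schwartz. \<forall>p. weighted_deriv \<alpha> \<beta> \<gamma> (T (U f)) p \<le> C * schwartz_seminorm M f"
    by blast
qed (use assms in \<open>auto simp: bounded_op_def\<close>)

lemma bounded_op_add:
  assumes "bounded_op T" "bounded_op U"
  shows "bounded_op (\<lambda>f t x. T f t x + U f t x)"
  unfolding bounded_op_def
proof (intro conjI ballI allI)
  fix \<alpha> \<beta> \<gamma>
  obtain M C where MC: "\<And>f p. f \<in> schwartz \<Longrightarrow> weighted_deriv \<alpha> \<beta> \<gamma> (T f) p \<le> C * schwartz_seminorm M f"
    using assms(1) unfolding bounded_op_def by meson
  obtain N D where ND: "\<And>f p. f \<in> schwartz \<Longrightarrow> weighted_deriv \<alpha> \<beta> \<gamma> (U f) p \<le> D * schwartz_seminorm N f"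
    using assms(2) unfolding bounded_op_def by meson
  have "weighted_deriv \<alpha> \<beta> \<gamma> (\<lambda>t x. T f t x + U f t x) p \<le> (\<bar>C\<bar> + \<bar>D\<bar>) * schwartz_seminorm (max M N) f"
    if "f \<in> schwartz" for f p
    using that
    by (intro order_trans[OF weighted_deriv_add seminorm_bound_add[OF that MC ND]]
        schwartz_smooth bounded_op_schwartz[OF assms(1)] bounded_op_schwartz[OF assms(2)])
  then show "\<exists>M C. \<forall>f\<in>schwartz. \<forall>p. weighted_deriv \<alpha> \<beta> \<gamma> (\<lambda>t x. T f t x + U f t x) p \<le> C * schwartz_seminorm M f"
    by blast
qed (use assms in \<open>auto simp: bounded_op_def intro: schwartz_add\<close>)

text \<open>
  The derivative of a product or of a shear of \<open>f\<close> is a sum of terms of the same kind, so families of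
  operators of interest are closed under differentiation only up to finite sums.
\<close>

inductive_set op_sums :: "(cylfun \<Rightarrow> cylfun) set \<Rightarrow> (cylfun \<Rightarrow> cylfun) set" for \<F> where
  base: "T \<in> \<F> \<Longrightarrow> T \<in> op_sums \<F>"
| add: "T \<in> op_sums \<F> \<Longrightarrow> U \<in> op_sums \<F> \<Longrightarrow> (\<lambda>f t x. T f t x + U f t x) \<in> op_sums \<F>"

text \<open>
  A coinduction principle for boundedness.  A family of operators that is closed, up to finite sums,
  under \<open>\<partial>\<^sub>t\<close>, \<open>\<partial>\<^sub>x\<close> and multiplication by \<open>x\<close> needs only a bound on the supremum norm of each
  member: a weighted derivative of \<open>T f\<close> is then \<open>U f\<close> for another sum \<open>U\<close> of members.
\<close>

lemma bounded_op_coinduct: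
  assumes cont: "\<And>T f. T \<in> \<F> \<Longrightarrow> f \<in> schwartz \<Longrightarrow> continuous_on UNIV (\<lambda>(t, x). T f t x)"
    and per: "\<And>T f t x. T \<in> \<F> \<Longrightarrow> f \<in> schwartz \<Longrightarrow> T f (t + 2 * pi) x = T f t x"
    and bound: "\<And>T. T \<in> \<F> \<Longrightarrow>
      \<exists>M C. \<forall>f\<in>schwartz. \<forall>t x. norm (T f t x) \<le> C * schwartz_seminorm M f"
    and deriv_t: "\<And>T. T \<in> \<F> \<Longrightarrow> \<exists>U\<in>op_sums \<F>. \<forall>f\<in>schwartz. \<forall>t x.
      ((\<lambda>s. T f s x) has_vector_derivative U f t x) (at t)"
    and deriv_x: "\<And>T. T \<in> \<F> \<Longrightarrow> \<exists>U\<in>op_sums \<F>. \<forall>f\<in>schwartz. \<forall>t x.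
      (T f t has_vector_derivative U f t x) (at x)"
    and mult_x: "\<And>T. T \<in> \<F> \<Longrightarrow> \<exists>U\<in>op_sums \<F>. \<forall>f\<in>schwartz. \<forall>t x.
      of_real x * T f t x = U f t x"
    and T: "T \<in> \<F>"
  shows "bounded_op T"
proof -
  let ?G = "op_sums \<F>"
  have cont': "continuous_on UNIV (\<lambda>(t, x). T f t x)" if "T \<in> ?G" "f \<in> schwartz" for T f
    using that
  proof (induction T)
    case (add T U)
    then show ?case
      using continuous_on_add[OF add.IH] by (simp add: case_prod_unfold)
  qed (rule cont)
  have per': "T f (t + 2 * pi) x = T f t x" if "T \<in> ?G" "f \<in> schwartz" for T f t x
    using that by (induction T) (auto simp: per)
  have bound': "\<exists>M C. \<forall>f\<in>schwartz. \<forall>t x. norm (T f t x) \<le> C * schwartz_seminorm M f" if "T \<in> ?G" for T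
    using that
  proof (induction T)
    case (add T U)
    then obtain M C N D where
      "\<And>f t x. f \<in> schwartz \<Longrightarrow> norm (T f t x) \<le> C * schwartz_seminorm M f"
      "\<And>f t x. f \<in> schwartz \<Longrightarrow> norm (U f t x) \<le> D * schwartz_seminorm N f"
      by blast
    then have "\<forall>f\<in>schwartz. \<forall>t x. norm (T f t x + U f t x) \<le> (\<bar>C\<bar> + \<bar>D\<bar>) * schwartz_seminorm (max M N) f"
      by (meson norm_triangle_ineq order_trans seminorm_bound_add)
    then show ?case by blast
  qed (rule bound)
  have deriv_t': "\<exists>U\<in>?G. \<forall>f\<in>schwartz. \<forall>t x. ((\<lambda>s. T f s x) has_vector_derivative U f t x) (at t)"
    if "T \<in> ?G" for T
    using that
  proof (induction T)
    case (add T U)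
    then obtain T' U' where "T' \<in> ?G" "U' \<in> ?G"
      "\<And>f t x. f \<in> schwartz \<Longrightarrow> ((\<lambda>s. T f s x) has_vector_derivative T' f t x) (at t)"
      "\<And>f t x. f \<in> schwartz \<Longrightarrow> ((\<lambda>s. U f s x) has_vector_derivative U' f t x) (at t)"
      by blast
    then show ?case
      by (intro bexI[of _ "\<lambda>f t x. T' f t x + U' f t x"])
         (auto intro!: op_sums.add has_vector_derivative_add)
  qed (rule deriv_t)
  have deriv_x': "\<exists>U\<in>?G. \<forall>f\<in>schwartz. \<forall>t x. (T f t has_vector_derivative U f t x) (at x)"
    if "T \<in> ?G" for T
    using that
  proof (induction T)
    case (add T U)
    then obtain T' U' where "T' \<in> ?G" "U' \<in> ?G"
      "\<And>f t x. f \<in> schwartz \<Longrightarrow> (T f t has_vector_derivative T' f t x) (at x)"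
      "\<And>f t x. f \<in> schwartz \<Longrightarrow> (U f t has_vector_derivative U' f t x) (at x)"
      by blast
    then show ?case
      by (intro bexI[of _ "\<lambda>f t x. T' f t x + U' f t x"])
         (auto intro!: op_sums.add has_vector_derivative_add)
  qed (rule deriv_x)
  have mult_x': "\<exists>U\<in>?G. \<forall>f\<in>schwartz. \<forall>t x. of_real x * T f t x = U f t x" if "T \<in> ?G" for T
    using that
  proof (induction T)
    case (add T U)
    then obtain T' U' where "T' \<in> ?G" "U' \<in> ?G"
      "\<And>f t x. f \<in> schwartz \<Longrightarrow> of_real x * T f t x = T' f t x"
      "\<And>f t x. f \<in> schwartz \<Longrightarrow> of_real x * U f t x = U' f t x"
      by blast
    then show ?case
      by (intro bexI[of _ "\<lambda>f t x. T' f t x + U' f t x"])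
         (auto intro!: op_sums.add simp: distrib_left)
  qed (rule mult_x)

  have D_t': "\<exists>U\<in>?G. \<forall>f\<in>schwartz. D_t (T f) = U f" if "T \<in> ?G" for T
  proof -
    obtain U where U: "U \<in> ?G" "\<forall>f\<in>schwartz. \<forall>t x. ((\<lambda>s. T f s x) has_vector_derivative U f t x) (at t)"
      using deriv_t'[OF \<open>T \<in> ?G\<close>] by blast
    then have "\<forall>f\<in>schwartz. D_t (T f) = U f"
      by (auto simp: D_t_def intro!: ext vector_derivative_at)
    with U(1) show ?thesis by blast
  qed
  have D_x': "\<exists>U\<in>?G. \<forall>f\<in>schwartz. D_x (T f) = U f" if "T \<in> ?G" for T
  proof -
    obtain U where U: "U \<in> ?G" "\<forall>f\<in>schwartz. \<forall>t x. (T f t has_vector_derivative U f t x) (at x)"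
      using deriv_x'[OF \<open>T \<in> ?G\<close>] by blast
    then have "\<forall>f\<in>schwartz. D_x (T f) = U f"
      by (auto simp: D_x_def intro!: ext vector_derivative_at)
    with U(1) show ?thesis by blast
  qed
  have smooth: "T f \<in> smooth_cylinder" if "T \<in> ?G" and f: "f \<in> schwartz" for T f
  proof -
    have "C_k k (T f)" for k
      using that(1)
    proof (induction k arbitrary: T)
      case 0
      then show ?case using cont' f by simp
    next
      case (Suc k)
      obtain U V where UV: "U \<in> ?G" "V \<in> ?G" "D_t (T f) = U f" "D_x (T f) = V f"
        using D_t'[OF Suc.prems] D_x'[OF Suc.prems] f by metis
      have "(\<lambda>s. T f s x) differentiable at t" "T f t differentiable at x" for t x
        using deriv_t'[OF Suc.prems] deriv_x'[OF Suc.prems] f by (meson differentiableI_vector)+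
      then show ?case
        using Suc.IH[OF UV(1)] Suc.IH[OF UV(2)] UV by simp
    qed
    then show ?thesis
      using per' that by (simp add: smooth_cylinder_def)
  qed
  have D_x_pow: "\<exists>U\<in>?G. \<forall>f\<in>schwartz. (D_x ^^ n) (T f) = U f" if "T \<in> ?G" for n T
    using that
  proof (induction n)
    case (Suc n)
    then show ?case using D_x' by (metis comp_apply funpow.simps(2))
  qed auto
  have D_t_pow: "\<exists>U\<in>?G. \<forall>f\<in>schwartz. (D_t ^^ n) (T f) = U f" if "T \<in> ?G" for n T
    using that
  proof (induction n)
    case (Suc n)
    then show ?case using D_t' by (metis comp_apply funpow.simps(2))
  qed auto
  have x_pow: "\<exists>U\<in>?G. \<forall>f\<in>schwartz. \<forall>t x. of_real x ^ n * T f t x = U f t x" if "T \<in> ?G" for n T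
    using that
  proof (induction n)
    case (Suc n)
    then obtain U V where "U \<in> ?G" "V \<in> ?G"
      "\<And>f t x. f \<in> schwartz \<Longrightarrow> of_real x ^ n * T f t x = U f t x"
      "\<And>f t x. f \<in> schwartz \<Longrightarrow> of_real x * U f t x = V f t x"
      using mult_x' by metis
    then have "of_real x ^ Suc n * T f t x = V f t x" if "f \<in> schwartz" for f t x
      using that by (metis mult.assoc power_Suc)
    with \<open>V \<in> ?G\<close> show ?case by blast
  qed auto
  have weighted: "\<exists>M C. \<forall>f\<in>schwartz. \<forall>p. weighted_deriv \<alpha> \<beta> \<gamma> (T f) p \<le> C * schwartz_seminorm M f"
    for \<alpha> \<beta> \<gamma>
  proof -
    obtain U where U: "U \<in> ?G" "\<forall>f\<in>schwartz. (D_x ^^ \<beta>) (T f) = U f"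
      using D_x_pow[OF op_sums.base[OF T]] by blast
    obtain V where V: "V \<in> ?G" "\<forall>f\<in>schwartz. (D_t ^^ \<alpha>) (U f) = V f"
      using D_t_pow[OF U(1)] by blast
    obtain W where W: "W \<in> ?G" "\<forall>f\<in>schwartz. \<forall>t x. of_real x ^ \<gamma> * V f t x = W f t x"
      using x_pow[OF V(1)] by blast
    have "weighted_deriv \<alpha> \<beta> \<gamma> (T f) (t, x) = norm (W f t x)" if "f \<in> schwartz" for f t x
      using U V W that by (simp add: weighted_deriv_def)
    moreover obtain M C where "\<forall>f\<in>schwartz. \<forall>t x. norm (W f t x) \<le> C * schwartz_seminorm M f"
      using bound'[OF W(1)] by blast
    ultimately have "\<forall>f\<in>schwartz. \<forall>p. weighted_deriv \<alpha> \<beta> \<gamma> (T f) p \<le> C * schwartz_seminorm M f"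
      by (simp add: split_paired_all)
    then show ?thesis by blast
  qed
  moreover have "T f \<in> schwartz" if "f \<in> schwartz" for f
  proof (rule schwartzI[OF smooth[OF op_sums.base[OF T] that]])
    fix \<alpha> \<beta> \<gamma>
    obtain M C where "\<forall>f\<in>schwartz. \<forall>p. weighted_deriv \<alpha> \<beta> \<gamma> (T f) p \<le> C * schwartz_seminorm M f"
      using weighted[of \<alpha> \<beta> \<gamma>] by blast
    with that show "\<exists>C. \<forall>p. weighted_deriv \<alpha> \<beta> \<gamma> (T f) p \<le> C"
      by blast
  qed
  ultimately show ?thesis
    by (simp add: bounded_op_def)
qed

text \<open>
  Taken together, these operators form a family closed under \<open>\<partial>\<^sub>t\<close>, \<open>\<partial>\<^sub>x\<close> and multiplication by \<open>x\<close>: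
  \<open>\<partial>\<^sub>x\<close> either lowers the power of \<open>x\<close> or moves past the \<open>\<partial>\<^sub>t\<close> by the symmetry of second derivatives.
  The basic operators below are special cases.
\<close>

lemma bounded_op_weighted_deriv:
  "bounded_op (\<lambda>f t x. c * of_real x ^ \<gamma> * (D_t ^^ \<alpha>) ((D_x ^^ \<beta>) f) t x)"
proof -
  define W :: "complex \<Rightarrow> nat \<Rightarrow> nat \<Rightarrow> nat \<Rightarrow> cylfun \<Rightarrow> cylfun" where
    "W c \<gamma> \<alpha> \<beta> = (\<lambda>f t x. c * of_real x ^ \<gamma> * (D_t ^^ \<alpha>) ((D_x ^^ \<beta>) f) t x)" for c \<gamma> \<alpha> \<beta>
  define \<F> where "\<F> = {W c \<gamma> \<alpha> \<beta> | c \<gamma> \<alpha> \<beta>. True}"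
  have smooth: "(D_t ^^ \<alpha>) ((D_x ^^ \<beta>) f) \<in> smooth_cylinder" if "f \<in> schwartz" for f \<alpha> \<beta>
    using that by (intro smooth_cylinder_funpow_D_t smooth_cylinder_funpow_D_x schwartz_smooth)
  have W_sums: "W c \<gamma> \<alpha> \<beta> \<in> op_sums \<F>" for c \<gamma> \<alpha> \<beta>
    by (rule op_sums.base) (auto simp: \<F>_def)
  have "bounded_op T" if "T \<in> \<F>" for T
    using _ _ _ _ _ _ that
  proof (rule bounded_op_coinduct)
    fix T f assume "T \<in> \<F>" and f: "f \<in> schwartz"
    then obtain c \<gamma> \<alpha> \<beta> where T: "T = W c \<gamma> \<alpha> \<beta>" by (auto simp: \<F>_def)
    show "continuous_on UNIV (\<lambda>(t, x). T f t x)"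
      unfolding T W_def case_prod_unfold
      by (intro continuous_intros smooth_cylinder_continuous_compose[OF smooth[OF f]])
    show "T f (t + 2 * pi) x = T f t x" for t x
      using smooth[OF f] by (simp add: T W_def smooth_cylinder_def)
  next
    fix T assume "T \<in> \<F>"
    then obtain c \<gamma> \<alpha> \<beta> where T: "T = W c \<gamma> \<alpha> \<beta>" by (auto simp: \<F>_def)
    have "norm (T f t x) \<le> norm c * schwartz_seminorm (\<alpha> + \<beta> + \<gamma>) f" if f: "f \<in> schwartz" for f t x
    proof -
      have "norm (T f t x) = norm c * weighted_deriv \<alpha> \<beta> \<gamma> f (t, x)"
        by (simp add: T W_def weighted_deriv_def norm_mult)
      also have "\<dots> \<le> norm c * schwartz_seminorm (\<alpha> + \<beta> + \<gamma>) f"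
        by (intro mult_left_mono order_trans[OF weighted_deriv_le_schwartz_norm schwartz_norm_le_seminorm] f) auto
      finally show ?thesis .
    qed
    then show "\<exists>M C. \<forall>f\<in>schwartz. \<forall>t x. norm (T f t x) \<le> C * schwartz_seminorm M f"
      by blast
    have "((\<lambda>s. T f s x) has_vector_derivative W c \<gamma> (Suc \<alpha>) \<beta> f t x) (at t)" if f: "f \<in> schwartz" for f t x
      unfolding T W_def funpow.simps comp_apply
      by (intro has_vector_derivative_mult_right smooth_cylinder_has_D_t smooth f)
    then show "\<exists>U\<in>op_sums \<F>. \<forall>f\<in>schwartz. \<forall>t x. ((\<lambda>s. T f s x) has_vector_derivative U f t x) (at t)"
      using W_sums by blast
    have "(T f t has_vector_derivative W (c * of_nat \<gamma>) (\<gamma> - 1) \<alpha> \<beta> f t x + W c \<gamma> \<alpha> (Suc \<beta>) f t x) (at x)"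
      if f: "f \<in> schwartz" for f t x
    proof -
      have "((\<lambda>x. complex_of_real x ^ \<gamma>) has_vector_derivative of_nat \<gamma> * of_real x ^ (\<gamma> - 1)) (at x)"
        by (intro has_vector_derivative_real_field) (auto intro!: derivative_eq_intros)
      from has_vector_derivative_mult[OF has_vector_derivative_mult_right[OF this, of c] smooth_cylinder_has_D_x[OF smooth[OF f, of \<alpha> \<beta>], of t]]
      show ?thesis
        using D_x_funpow_D_t_commute[OF smooth_cylinder_funpow_D_x[OF schwartz_smooth[OF f]], of \<alpha> \<beta>]
        by (simp add: T W_def algebra_simps)
    qed
    then show "\<exists>U\<in>op_sums \<F>. \<forall>f\<in>schwartz. \<forall>t x. (T f t has_vector_derivative U f t x) (at x)"
      by (intro bexI[OF _ op_sums.add[OF W_sums W_sums]]) blast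
    have "of_real x * T f t x = W c (Suc \<gamma>) \<alpha> \<beta> f t x" for f t x
      by (simp add: T W_def)
    then show "\<exists>U\<in>op_sums \<F>. \<forall>f\<in>schwartz. \<forall>t x. of_real x * T f t x = U f t x"
      using W_sums by blast
  qed
  moreover have "W c \<gamma> \<alpha> \<beta> \<in> \<F>"
    unfolding \<F>_def by blast
  ultimately have "bounded_op (W c \<gamma> \<alpha> \<beta>)"
    by blast
  then show ?thesis
    by (simp add: W_def)
qed

lemma bounded_op_D_t: "bounded_op D_t"
  using bounded_op_weighted_deriv[of 1 0 1 0] by simp

lemma bounded_op_D_x: "bounded_op D_x"
  using bounded_op_weighted_deriv[of 1 0 0 1] by simp

lemma bounded_op_mult_x: "bounded_op (\<lambda>f t x. of_real x * f t x)"
  using bounded_op_weighted_deriv[of 1 1 0 0] by simp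

lemma bounded_op_scale: "bounded_op (\<lambda>f t x. c * f t x)"
  using bounded_op_weighted_deriv[of c 0 0 0] by simp

lemma bounded_op_id: "bounded_op (\<lambda>f. f)"
  using bounded_op_scale[of 1] by simp

lemma bounded_op_sup_norm:
  assumes "bounded_op T"
  shows "\<exists>M C. C \<ge> 0 \<and> (\<forall>f\<in>schwartz. \<forall>t x. norm (T f t x) \<le> C * schwartz_seminorm M f)"
proof -
  obtain M C where MC: "\<forall>f\<in>schwartz. \<forall>p. weighted_deriv 0 0 0 (T f) p \<le> C * schwartz_seminorm M f"
    using assms unfolding bounded_op_def by blast
  have "norm (T f t x) \<le> \<bar>C\<bar> * schwartz_seminorm M f" if f: "f \<in> schwartz" for f t x
  proof -
    have "norm (T f t x) = weighted_deriv 0 0 0 (T f) (t, x)"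
      by (simp add: weighted_deriv_def)
    also have "\<dots> \<le> C * schwartz_seminorm M f"
      using MC f by blast
    also have "\<dots> \<le> \<bar>C\<bar> * schwartz_seminorm M f"
      by (intro mult_right_mono schwartz_seminorm_nonneg f) auto
    finally show ?thesis .
  qed
  then show ?thesis
    by (intro exI[of _ M] exI[of _ "\<bar>C\<bar>"]) auto
qed

text \<open>
  The two ways in which \<open>A(t)\<close> acts, by translation in \<open>x\<close> and by the character \<open>exp (i x A(t))\<close> on the
  Fourier side, are treated together: the former is the case \<open>B = 0\<close>, the latter the case \<open>A = 0\<close>.
\<close>

definition twisted_shear ::
    "(real \<Rightarrow> complex) \<Rightarrow> (real \<Rightarrow> real) \<Rightarrow> (real \<Rightarrow> real) \<Rightarrow> cylfun \<Rightarrow> cylfun" where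
  "twisted_shear m B A f = (\<lambda>t x. m t * exp (\<i> * of_real x * of_real (B t)) * f t (x - A t))"

lemma twisted_shear_D_t:
  assumes "m \<in> smooth_circle" "B \<in> smooth_circle" "A \<in> smooth_circle" "f \<in> smooth_cylinder"
  shows "((\<lambda>s. twisted_shear m B A f s x) has_vector_derivative
    twisted_shear (circle_deriv m) B A f t x +
    \<i> * of_real (circle_deriv B t) * (of_real x * twisted_shear m B A f t x) +
    twisted_shear m B A (D_t f) t x -
    of_real (circle_deriv A t) * twisted_shear m B A (D_x f) t x) (at t)"
proof -
  let ?e = "\<lambda>t. exp (\<i> * of_real x * of_real (B t))"
  have "((\<lambda>t. \<i> * of_real x * of_real (B t)) has_vector_derivative \<i> * of_real x * of_real (circle_deriv B t)) (at t)"
    by (intro has_vector_derivative_mult_right has_vector_derivative_of_real assms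
        has_real_derivative_iff_has_vector_derivative[THEN iffD2] smooth_circle_derivative)
  from field_vector_diff_chain_at[OF this DERIV_exp]
  have e: "(?e has_vector_derivative \<i> * of_real x * of_real (circle_deriv B t) * ?e t) (at t)"
    by (simp add: o_def)
  have "((\<lambda>s. x - A s) has_vector_derivative - circle_deriv A t) (at t)"
    using has_vector_derivative_diff[OF has_vector_derivative_const smooth_circle_derivative[OF assms(3)]]
    by simp
  from smooth_cylinder_chain_rule[OF assms(4) this]
  have f: "((\<lambda>s. f s (x - A s)) has_vector_derivative
    D_t f t (x - A t) - of_real (circle_deriv A t) * D_x f t (x - A t)) (at t)"
    by (simp add: scaleR_conv_of_real)
  show ?thesis
    using has_vector_derivative_mult[OF has_vector_derivative_mult[OF smooth_circle_derivative[OF assms(1)] e] f]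
    by (simp add: twisted_shear_def algebra_simps)
qed

lemma twisted_shear_D_x:
  assumes "f \<in> smooth_cylinder"
  shows "(twisted_shear m B A f t has_vector_derivative
    \<i> * of_real (B t) * twisted_shear m B A f t x + twisted_shear m B A (D_x f) t x) (at x)"
proof -
  let ?e = "\<lambda>x. exp (\<i> * of_real x * of_real (B t))"
  have e: "((\<lambda>x. m t * ?e x) has_vector_derivative m t * (\<i> * of_real (B t) * ?e x)) (at x)"
    by (intro has_vector_derivative_mult_right has_vector_derivative_real_field)
       (auto intro!: derivative_eq_intros)
  have "(f t \<circ> (\<lambda>y. y - A t) has_vector_derivative 1 *\<^sub>R D_x f t (x - A t)) (at x)"
    by (intro vector_diff_chain_at smooth_cylinder_has_D_x assms) (auto intro!: derivative_eq_intros)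
  then have f: "((\<lambda>y. f t (y - A t)) has_vector_derivative D_x f t (x - A t)) (at x)"
    by (simp add: o_def)
  show ?thesis
    using has_vector_derivative_mult[OF e f]
    by (simp add: twisted_shear_def algebra_simps)
qed

text \<open>
  The coefficient \<open>m\<close> varies over all smooth functions in the family to which coinduction is applied,
  since every derivative of \<open>m\<close>, \<open>B\<close> or \<open>A\<close> is absorbed into it. The factors \<open>x\<close> produced by
  differentiating the exponential in \<open>t\<close> are written as \<open>(x - A t) + A t\<close>: the first summand multiplies
  \<open>f\<close> by its own variable before the shear, the second is again absorbed into \<open>m\<close>.
\<close>

lemma bounded_op_twisted_shear:
  assumes m: "m \<in> smooth_circle" and B: "B \<in> smooth_circle" and A: "A \<in> smooth_circle"
  shows "bounded_op (twisted_shear m B A)"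
proof -
  let ?S = "\<lambda>m T f. twisted_shear m B A (T f)"
  define \<F> where "\<F> = {?S m T | m T. m \<in> smooth_circle \<and> bounded_op T}"
  have S_sums: "?S m T \<in> op_sums \<F>" if "m \<in> smooth_circle" "bounded_op T" for m T
    using that by (intro op_sums.base) (auto simp: \<F>_def)
  let ?B = "\<lambda>t. complex_of_real (B t)" and ?A = "\<lambda>t. complex_of_real (A t)"
  let ?B' = "\<lambda>t. complex_of_real (circle_deriv B t)" and ?A' = "\<lambda>t. complex_of_real (circle_deriv A t)"
  let ?x = "\<lambda>f t x. of_real x * f t x"
  note coeff = smooth_circle_add smooth_circle_mult smooth_circle_const smooth_circle_of_real
    smooth_circle_deriv A B
  have "bounded_op T" if "T \<in> \<F>" for T
    using _ _ _ _ _ _ that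
  proof (rule bounded_op_coinduct)
    fix T f assume "T \<in> \<F>" and f: "f \<in> schwartz"
    then obtain m U where T: "T = ?S m U" and m: "m \<in> smooth_circle" and U: "bounded_op U"
      by (auto simp: \<F>_def)
    have Uf: "U f \<in> schwartz"
      using U f by (rule bounded_op_schwartz)
    note cont = continuous_on_compose2[OF smooth_circle_continuous[where S = UNIV] continuous_on_fst[OF continuous_on_id]]
    show "continuous_on UNIV (\<lambda>(t, x). T f t x)"
      unfolding T twisted_shear_def case_prod_unfold
      by (intro continuous_intros smooth_cylinder_continuous_compose[OF schwartz_smooth[OF Uf]]
          cont[OF m] cont[OF A] cont[OF B]) auto
    show "T f (t + 2 * pi) x = T f t x" for t x
      by (simp add: T twisted_shear_def smooth_circle_periodic[OF m] smooth_circle_periodic[OF A]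
          smooth_circle_periodic[OF B] schwartz_periodic[OF Uf])
  next
    fix T assume "T \<in> \<F>"
    then obtain m U where T: "T = ?S m U" and m: "m \<in> smooth_circle" and U: "bounded_op U"
      by (auto simp: \<F>_def)
    have smooth: "U f \<in> smooth_cylinder" if "f \<in> schwartz" for f
      by (rule schwartz_smooth[OF bounded_op_schwartz[OF U that]])
    obtain K where K: "K \<ge> 0" "\<And>t. norm (m t) \<le> K"
      using smooth_circle_bounded[OF m] by blast
    obtain M C where MC: "C \<ge> 0" "\<forall>f\<in>schwartz. \<forall>t x. norm (U f t x) \<le> C * schwartz_seminorm M f"
      using bounded_op_sup_norm[OF U] by blast
    have "norm (T f t x) \<le> K * C * schwartz_seminorm M f" if f: "f \<in> schwartz" for f t x
    proof -
      have "norm (T f t x) = norm (m t) * norm (U f t (x - A t))"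
        by (simp add: T twisted_shear_def norm_mult)
      also have "\<dots> \<le> K * (C * schwartz_seminorm M f)"
        using K MC f by (intro mult_mono) auto
      finally show ?thesis by simp
    qed
    then show "\<exists>M C. \<forall>f\<in>schwartz. \<forall>t x. norm (T f t x) \<le> C * schwartz_seminorm M f"
      by blast

    let ?T1 = "?S (\<lambda>t. circle_deriv m t + \<i> * ?B' t * ?A t * m t) U"
      and ?T2 = "?S (\<lambda>t. \<i> * ?B' t * m t) (\<lambda>f. ?x (U f))"
      and ?T3 = "?S m (\<lambda>f. D_t (U f))"
      and ?T4 = "?S (\<lambda>t. - 1 * ?A' t * m t) (\<lambda>f. D_x (U f))"
    have "((\<lambda>s. T f s x) has_vector_derivative ?T1 f t x + ?T2 f t x + ?T3 f t x + ?T4 f t x) (at t)"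
      if f: "f \<in> schwartz" for f t x
      using twisted_shear_D_t[OF m B A smooth[OF f], of x t]
      by (simp add: T twisted_shear_def algebra_simps)
    moreover have "(\<lambda>f t x. ?T1 f t x + ?T2 f t x + ?T3 f t x + ?T4 f t x) \<in> op_sums \<F>"
      by (intro op_sums.add S_sums coeff m U bounded_op_compose[OF bounded_op_mult_x]
          bounded_op_compose[OF bounded_op_D_t] bounded_op_compose[OF bounded_op_D_x])
    ultimately show "\<exists>U\<in>op_sums \<F>. \<forall>f\<in>schwartz. \<forall>t x. ((\<lambda>s. T f s x) has_vector_derivative U f t x) (at t)"
      by (intro bexI) auto

    let ?T1 = "?S (\<lambda>t. \<i> * ?B t * m t) U" and ?T2 = "?S m (\<lambda>f. D_x (U f))"
    have "(T f t has_vector_derivative ?T1 f t x + ?T2 f t x) (at x)" if f: "f \<in> schwartz" for f t x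
      using twisted_shear_D_x[OF smooth[OF f], of m B A t x]
      by (simp add: T twisted_shear_def algebra_simps)
    moreover have "(\<lambda>f t x. ?T1 f t x + ?T2 f t x) \<in> op_sums \<F>"
      by (intro op_sums.add S_sums coeff m U bounded_op_compose[OF bounded_op_D_x])
    ultimately show "\<exists>U\<in>op_sums \<F>. \<forall>f\<in>schwartz. \<forall>t x. (T f t has_vector_derivative U f t x) (at x)"
      by (intro bexI) auto

    let ?T1 = "?S m (\<lambda>f. ?x (U f))" and ?T2 = "?S (\<lambda>t. ?A t * m t) U"
    have "of_real x * T f t x = ?T1 f t x + ?T2 f t x" for f t x
      by (simp add: T twisted_shear_def algebra_simps)
    moreover have "(\<lambda>f t x. ?T1 f t x + ?T2 f t x) \<in> op_sums \<F>"
      by (intro op_sums.add S_sums coeff m U bounded_op_compose[OF bounded_op_mult_x])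
    ultimately show "\<exists>U\<in>op_sums \<F>. \<forall>f\<in>schwartz. \<forall>t x. of_real x * T f t x = U f t x"
      by (intro bexI) auto
  qed
  moreover have "twisted_shear m B A \<in> \<F>"
    using m bounded_op_id by (auto simp: \<F>_def)
  ultimately show ?thesis by blast
qed

lemma bounded_op_mult:
  assumes "m \<in> smooth_circle"
  shows "bounded_op (\<lambda>f t x. m t * f t x)"
  using bounded_op_twisted_shear[OF assms smooth_circle_const[of 0] smooth_circle_const[of 0]]
  by (simp add: twisted_shear_def[abs_def])

section \<open>Transposed operators on tempered distributions\<close>

definition linear_op :: "(cylfun \<Rightarrow> cylfun) \<Rightarrow> bool" where
  "linear_op T \<longleftrightarrow>
     (\<forall>f\<in>schwartz. \<forall>g\<in>schwartz. T (\<lambda>t x. f t x + g t x) = (\<lambda>t x. T f t x + T g t x)) \<and>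
     (\<forall>c. \<forall>f\<in>schwartz. T (\<lambda>t x. c * f t x) = (\<lambda>t x. c * T f t x))"

lemma linear_op_add:
  "linear_op T \<Longrightarrow> f \<in> schwartz \<Longrightarrow> g \<in> schwartz \<Longrightarrow>
    T (\<lambda>t x. f t x + g t x) = (\<lambda>t x. T f t x + T g t x)"
  by (simp add: linear_op_def)

lemma linear_op_scale:
  "linear_op T \<Longrightarrow> f \<in> schwartz \<Longrightarrow> T (\<lambda>t x. c * f t x) = (\<lambda>t x. c * T f t x)"
  by (simp add: linear_op_def)

lemma linear_op_diff:
  assumes "linear_op T" "f \<in> schwartz" "g \<in> schwartz"
  shows "T (\<lambda>t x. f t x - g t x) = (\<lambda>t x. T f t x - T g t x)"
  using linear_op_add[OF assms(1,2) schwartz_scale[OF assms(3), of "-1"]]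
    linear_op_scale[OF assms(1,3), of "-1"]
  by simp

lemma schwartz_ball_center:
  assumes "f \<in> schwartz" "\<epsilon> > 0"
  shows "f \<in> schwartz_ball N f \<epsilon>"
proof -
  have "weighted_deriv \<alpha> \<beta> \<gamma> (\<lambda>t x. f t x - f t x) p \<le> 0" for \<alpha> \<beta> \<gamma> p
    using weighted_deriv_scale[OF schwartz_smooth[OF assms(1)], of \<alpha> \<beta> \<gamma> 0 p] by simp
  then have "schwartz_seminorm N (\<lambda>t x. f t x - f t x) \<le> 0"
    unfolding schwartz_seminorm_def by (intro sum_nonpos) (auto intro: schwartz_norm_leI)
  with assms show ?thesis
    by (simp add: schwartz_ball_def)
qed

lemma topspace_schwartz: "topspace schwartz_topology = schwartz"
proof
  show "topspace schwartz_topology \<subseteq> schwartz"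
    by (auto simp: schwartz_topology_def schwartz_ball_def)
  show "schwartz \<subseteq> topspace schwartz_topology"
  proof
    fix f assume f: "f \<in> schwartz"
    then have "f \<in> schwartz_ball 0 f 1"
      by (rule schwartz_ball_center) simp
    moreover have "schwartz_ball 0 f 1 \<in> {schwartz_ball N f \<epsilon> |N f \<epsilon>. f \<in> schwartz \<and> \<epsilon> > 0}"
      using f zero_less_one by blast
    ultimately show "f \<in> topspace schwartz_topology"
      unfolding schwartz_topology_def topology_generated_by_topspace by blast
  qed
qed

text \<open>
  The topology is generated by balls with arbitrary centres, so the preimage of a ball has to contain a
  ball around each of its points, as in the usual argument for metric spaces.
\<close>

lemma bounded_op_continuous:
  assumes T: "bounded_op T" "linear_op T"
  shows "continuous_map schwartz_topology schwartz_topology T"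
proof -
  let ?\<B> = "{schwartz_ball N f \<epsilon> |N f \<epsilon>. f \<in> schwartz \<and> \<epsilon> > 0}"
  have "openin schwartz_topology (T -` S \<inter> topspace schwartz_topology)" if "S \<in> ?\<B>" for S
  proof -
    from that obtain N f \<epsilon> where S: "S = schwartz_ball N f \<epsilon>" and f: "f \<in> schwartz"
      by blast
    obtain M C where C: "C \<ge> 0" "\<And>g. g \<in> schwartz \<Longrightarrow> schwartz_seminorm N (T g) \<le> C * schwartz_seminorm M g"
      using bounded_op_seminorm[OF T(1), of N] by blast
    have "\<exists>V. openin schwartz_topology V \<and> g \<in> V \<and> V \<subseteq> T -` S \<inter> topspace schwartz_topology"
      if "g \<in> T -` S \<inter> topspace schwartz_topology" for g
    proof -
      have g: "g \<in> schwartz" and Tg: "T g \<in> schwartz"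
        using that bounded_op_schwartz[OF T(1)] by (auto simp: topspace_schwartz)
      define \<delta> where "\<delta> = \<epsilon> - schwartz_seminorm N (\<lambda>t x. T g t x - f t x)"
      have "\<delta> > 0"
        using that by (simp add: \<delta>_def S schwartz_ball_def)
      \<comment> \<open>\<open>C + 1\<close> instead of \<open>C\<close>, since \<open>C\<close> may be \<open>0\<close>\<close>
      define V where "V = schwartz_ball M g (\<delta> / (C + 1))"
      have r: "\<delta> / (C + 1) > 0"
        using \<open>\<delta> > 0\<close> C(1) by simp
      have "openin schwartz_topology V"
        unfolding schwartz_topology_def V_def by (rule topology_generated_by_Basis) (use g r in blast)
      moreover have "g \<in> V"
        unfolding V_def by (rule schwartz_ball_center[OF g r])
      moreover have "V \<subseteq> T -` S \<inter> topspace schwartz_topology"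
      proof
        fix h assume "h \<in> V"
        then have h: "h \<in> schwartz" and hg: "schwartz_seminorm M (\<lambda>t x. h t x - g t x) < \<delta> / (C + 1)"
          by (auto simp: V_def schwartz_ball_def)
        have Th: "T h \<in> schwartz"
          using h by (rule bounded_op_schwartz[OF T(1)])
        have "schwartz_seminorm N (\<lambda>t x. T h t x - T g t x) \<le> C * schwartz_seminorm M (\<lambda>t x. h t x - g t x)"
          using C(2)[OF schwartz_diff[OF h g]] by (simp add: linear_op_diff[OF T(2) h g])
        also have "\<dots> \<le> C * (\<delta> / (C + 1))"
          using hg C(1) by (intro mult_left_mono) auto
        also have "\<dots> < \<delta>"
          using \<open>\<delta> > 0\<close> C(1) by (simp add: field_simps)
        finally have "schwartz_seminorm N (\<lambda>t x. T h t x - T g t x) +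
            schwartz_seminorm N (\<lambda>t x. T g t x - f t x) < \<epsilon>"
          by (simp add: \<delta>_def)
        moreover have "schwartz_seminorm N (\<lambda>t x. T h t x - f t x) \<le>
            schwartz_seminorm N (\<lambda>t x. T h t x - T g t x) + schwartz_seminorm N (\<lambda>t x. T g t x - f t x)"
          using schwartz_seminorm_triangle[OF schwartz_diff[OF Th Tg] schwartz_diff[OF Tg f]] by simp
        ultimately show "h \<in> T -` S \<inter> topspace schwartz_topology"
          using h Th by (simp add: S schwartz_ball_def topspace_schwartz)
      qed
      ultimately show ?thesis by blast
    qed
    then show ?thesis
      by (subst openin_subopen) blast
  qed
  moreover have "T ` topspace schwartz_topology \<subseteq> \<Union> ?\<B>"
    using bounded_op_schwartz[OF T(1)] topspace_schwartz
    unfolding schwartz_topology_def topology_generated_by_topspace by blast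
  ultimately show ?thesis
    unfolding schwartz_topology_def[symmetric]
    using continuous_on_generated_topo[of ?\<B> schwartz_topology T]
    unfolding schwartz_topology_def by blast
qed

definition transposed :: "(cylfun \<Rightarrow> cylfun) \<Rightarrow> functional \<Rightarrow> functional" where
  "transposed T u = (\<lambda>f\<in>schwartz. u (T f))"

lemma tempered_transposed:
  assumes T: "bounded_op T" "linear_op T" and u: "u \<in> tempered"
  shows "transposed T u \<in> tempered"
proof -
  have "continuous_map schwartz_topology euclidean (u \<circ> T)"
    using u by (intro continuous_map_compose[OF bounded_op_continuous[OF T]]) (simp add: tempered_def)
  then have "continuous_map schwartz_topology euclidean (transposed T u)"
    by (rule continuous_map_eq) (simp add: transposed_def topspace_schwartz)
  then show ?thesis
    using u T(2) bounded_op_schwartz[OF T(1)]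
    by (auto simp: tempered_def transposed_def linear_op_def schwartz_add schwartz_scale)
qed

section \<open>The partial Fourier transform\<close>

subsection \<open>Differentiation under the integral sign\<close>

lemma has_vector_derivativeI_sequentially:
  fixes F :: "real \<Rightarrow> 'a::real_normed_vector"
  assumes "\<And>X. (\<And>n. X n \<noteq> t) \<Longrightarrow> X \<longlonglongrightarrow> t \<Longrightarrow> (\<lambda>n. (F (X n) - F t) /\<^sub>R (X n - t)) \<longlonglongrightarrow> D"
  shows "(F has_vector_derivative D) (at t)"
proof -
  have "((\<lambda>s. norm (F s - F t - (s - t) *\<^sub>R D) / norm (s - t)) \<longlongrightarrow> 0) (at t)"
    unfolding tendsto_at_iff_sequentially comp_def
  proof (intro allI impI)
    fix X assume X: "\<forall>n. X n \<in> UNIV - {t}" "X \<longlonglongrightarrow> t"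
    have "(\<lambda>n. norm ((F (X n) - F t) /\<^sub>R (X n - t) - D)) \<longlonglongrightarrow> 0"
      using assms[of X] X by (intro tendsto_norm_zero) (auto simp: LIM_zero_iff)
    moreover have "norm ((F (X n) - F t) /\<^sub>R (X n - t) - D) =
        norm (F (X n) - F t - (X n - t) *\<^sub>R D) / norm (X n - t)" for n
    proof -
      have "X n - t \<noteq> 0" using X by auto
      then have "(F (X n) - F t) /\<^sub>R (X n - t) - D = (F (X n) - F t - (X n - t) *\<^sub>R D) /\<^sub>R (X n - t)"
        by (simp add: scaleR_diff_right)
      then show ?thesis by (simp add: divide_inverse mult.commute)
    qed
    ultimately show "(\<lambda>n. norm (F (X n) - F t - (X n - t) *\<^sub>R D) / norm (X n - t)) \<longlonglongrightarrow> 0"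
      by simp
  qed
  then show ?thesis
    by (simp add: has_vector_derivative_def has_derivative_iff_norm bounded_linear_scaleR_left)
qed

text \<open>
  By the mean value inequality \<open>w\<close> also dominates the difference quotients, and dominated convergence
  applies along every sequence \<open>X n \<rightarrow> t\<close>.
\<close>

lemma has_vector_derivative_integral:
  fixes h :: "real \<Rightarrow> 'b \<Rightarrow> 'a::{banach, second_countable_topology}"
  assumes int: "\<And>s. integrable M (h s)"
    and deriv: "\<And>s y. ((\<lambda>s. h s y) has_vector_derivative h' s y) (at s)"
    and bound: "\<And>s y. norm (h' s y) \<le> w y" and w: "integrable M w"
    and meas: "h' t \<in> borel_measurable M"
  shows "((\<lambda>s. integral\<^sup>L M (h s)) has_vector_derivative integral\<^sup>L M (h' t)) (at t)"
proof (rule has_vector_derivativeI_sequentially)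
  fix X assume X: "\<And>n. X n \<noteq> t" "X \<longlonglongrightarrow> t"
  have lim: "(\<lambda>n. (h (X n) y - h t y) /\<^sub>R (X n - t)) \<longlonglongrightarrow> h' t y" for y
  proof -
    have "((\<lambda>s. (h s y - h t y) /\<^sub>R (s - t)) \<longlongrightarrow> h' t y) (at t)"
    proof -
      have "((\<lambda>s. norm (h s y - h t y - (s - t) *\<^sub>R h' t y) / norm (s - t)) \<longlongrightarrow> 0) (at t)"
        using deriv[where s = t and y = y] by (simp add: has_vector_derivative_def has_derivative_iff_norm)
      then have "((\<lambda>s. norm ((h s y - h t y) /\<^sub>R (s - t) - h' t y)) \<longlongrightarrow> 0) (at t)"
      proof (rule Lim_transform_eventually)
        have "norm (h s y - h t y - (s - t) *\<^sub>R h' t y) / norm (s - t) =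
            norm ((h s y - h t y) /\<^sub>R (s - t) - h' t y)" if "s \<noteq> t" for s
        proof -
          have "(h s y - h t y) /\<^sub>R (s - t) - h' t y = (h s y - h t y - (s - t) *\<^sub>R h' t y) /\<^sub>R (s - t)"
            using that by (simp add: scaleR_diff_right)
          then show ?thesis by (simp add: divide_inverse mult.commute)
        qed
        then show "\<forall>\<^sub>F s in at t. norm (h s y - h t y - (s - t) *\<^sub>R h' t y) / norm (s - t) =
            norm ((h s y - h t y) /\<^sub>R (s - t) - h' t y)"
          by (simp add: eventually_at_filter)
      qed
      then show ?thesis
        by (simp add: tendsto_norm_zero_iff LIM_zero_iff)
    qed
    then show ?thesis
      using X unfolding tendsto_at_iff_sequentially comp_def by auto
  qed
  have lipschitz: "norm (h s y - h t y) \<le> w y * norm (s - t)" for s y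
  proof (rule differentiable_bound[of UNIV])
    show "((\<lambda>s. h s y) has_derivative (\<lambda>r. r *\<^sub>R h' s y)) (at s within UNIV)" for s
      using deriv by (simp add: has_vector_derivative_def)
    show "onorm (\<lambda>r. r *\<^sub>R h' s y) \<le> w y" for s
      by (rule onorm_le) (use mult_right_mono[OF bound] in \<open>simp add: mult.commute\<close>)
  qed auto
  then have quotient: "norm ((h (X n) y - h t y) /\<^sub>R (X n - t)) \<le> w y" for n y
  proof -
    have "norm ((h (X n) y - h t y) /\<^sub>R (X n - t)) = norm (h (X n) y - h t y) / norm (X n - t)"
      by (simp add: divide_inverse mult.commute)
    also have "\<dots> \<le> w y"
      using X(1)[of n] lipschitz[of "X n" y] by (simp add: pos_divide_le_eq)
    finally show ?thesis .
  qed
  have "(\<lambda>n. LINT y|M. (h (X n) y - h t y) /\<^sub>R (X n - t)) \<longlonglongrightarrow> integral\<^sup>L M (h' t)"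
    by (rule integral_dominated_convergence[where w = w])
       (use lim quotient int w meas in auto)
  moreover have "(LINT y|M. (h (X n) y - h t y) /\<^sub>R (X n - t)) =
      (integral\<^sup>L M (h (X n)) - integral\<^sup>L M (h t)) /\<^sub>R (X n - t)" for n
    using int by simp
  ultimately show "(\<lambda>n. (integral\<^sup>L M (h (X n)) - integral\<^sup>L M (h t)) /\<^sub>R (X n - t)) \<longlonglongrightarrow> integral\<^sup>L M (h' t)"
    by (simp only:)
qed

subsection \<open>Decay and integrability\<close>

lemma integrable_inverse_1_plus_square': "integrable lborel (\<lambda>x::real. inverse (1 + x\<^sup>2))"
  using integrable_inverse_1_plus_square by (simp add: set_integrable_def einterval_def)

text \<open>
  An integrable majorant that is uniform in \<open>t\<close>; all integrals over the line below are dominated by it.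
\<close>

lemma schwartz_decay:
  assumes "f \<in> schwartz"
  shows "norm (f t x) \<le> 2 * schwartz_seminorm 2 f * inverse (1 + x\<^sup>2)"
proof -
  have "norm (f t x) = weighted_deriv 0 0 0 f (t, x)" "x\<^sup>2 * norm (f t x) = weighted_deriv 0 0 2 f (t, x)"
    by (simp_all add: weighted_deriv_def norm_mult norm_power)
  moreover have "weighted_deriv 0 0 0 f (t, x) \<le> schwartz_seminorm 2 f"
      "weighted_deriv 0 0 2 f (t, x) \<le> schwartz_seminorm 2 f"
    by (rule order_trans[OF weighted_deriv_le_schwartz_norm[OF assms] schwartz_norm_le_seminorm[OF assms]];
        simp)+
  ultimately have "(1 + x\<^sup>2) * norm (f t x) \<le> 2 * schwartz_seminorm 2 f"
    by (simp add: distrib_right)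
  moreover have "1 + x\<^sup>2 > 0"
    by (simp add: add_pos_nonneg)
  ultimately show ?thesis
    by (simp add: field_simps)
qed

lemma schwartz_slice_continuous: "f \<in> schwartz \<Longrightarrow> continuous_on UNIV (f t)"
  using smooth_cylinder_continuous_compose[OF schwartz_smooth, of f UNIV "\<lambda>_. t" "\<lambda>y. y"] by simp

lemma schwartz_slice_measurable: "f \<in> schwartz \<Longrightarrow> f t \<in> borel_measurable borel"
  by (intro borel_measurable_continuous_onI schwartz_slice_continuous)

lemma schwartz_mult_integrable:
  assumes "f \<in> schwartz" and "e \<in> borel_measurable borel" and "\<And>y. norm (e y) \<le> 1"
  shows "integrable lborel (\<lambda>y. f t y * (e y :: complex))"
proof (rule Bochner_Integration.integrable_bound)
  show "integrable lborel (\<lambda>x. 2 * schwartz_seminorm 2 f * inverse (1 + x\<^sup>2))"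
    by (intro integrable_mult_right integrable_inverse_1_plus_square')
  show "(\<lambda>y. f t y * e y) \<in> borel_measurable lborel"
    using schwartz_slice_measurable[OF assms(1)] assms(2) by simp
  show "AE y in lborel. norm (f t y * e y) \<le> norm (2 * schwartz_seminorm 2 f * inverse (1 + y\<^sup>2))"
  proof (rule AE_I2)
    fix y
    have "norm (f t y * e y) \<le> norm (f t y)"
      using mult_left_mono[OF assms(3)[of y] norm_ge_zero[of "f t y"]] by (simp add: norm_mult)
    also have "\<dots> \<le> 2 * schwartz_seminorm 2 f * inverse (1 + y\<^sup>2)"
      by (rule schwartz_decay[OF assms(1)])
    finally show "norm (f t y * e y) \<le> norm (2 * schwartz_seminorm 2 f * inverse (1 + y\<^sup>2))"
      by simp
  qed
qed

lemma schwartz_slice_integrable: "f \<in> schwartz \<Longrightarrow> integrable lborel (f t)"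
  using schwartz_mult_integrable[of f "\<lambda>_. 1"] by simp

lemma schwartz_slice_tendsto_0:
  assumes "f \<in> schwartz"
  shows "(f t \<longlongrightarrow> 0) at_top" "(f t \<longlongrightarrow> 0) at_bot"
proof -
  let ?K = "2 * schwartz_seminorm 2 f"
  have *: "((\<lambda>x::real. ?K * inverse (1 + x\<^sup>2)) \<longlongrightarrow> 0) F" if "filterlim (\<lambda>x. x\<^sup>2) at_top F" for F
    by (intro tendsto_mult_right_zero tendsto_inverse_0_at_top filterlim_tendsto_add_at_top[OF tendsto_const] that)
  show "(f t \<longlongrightarrow> 0) at_top"
    by (rule Lim_null_comparison[OF always_eventually *])
       (auto intro: schwartz_decay[OF assms] filterlim_pow_at_top filterlim_ident)
  show "(f t \<longlongrightarrow> 0) at_bot"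
    by (rule Lim_null_comparison[OF always_eventually *])
       (auto intro: schwartz_decay[OF assms] filterlim_pow_at_bot_even filterlim_ident)
qed

subsection \<open>The inverse transform preserves Schwartz functions\<close>

lemma iexp_measurable: "(\<lambda>y. exp (\<i> * of_real x * complex_of_real y)) \<in> borel_measurable borel"
  by (intro borel_measurable_continuous_onI continuous_intros)

lemma inv_fourier_D_t:
  assumes f: "f \<in> schwartz"
  shows "((\<lambda>s. inv_fourier f s x) has_vector_derivative inv_fourier (D_t f) t x) (at t)"
proof -
  have Df: "D_t f \<in> schwartz"
    using f by (rule bounded_op_schwartz[OF bounded_op_D_t])
  let ?e = "\<lambda>y. exp (\<i> * of_real x * complex_of_real y)"
  have "((\<lambda>s. LINT y|lborel. f s y * ?e y) has_vector_derivative (LINT y|lborel. D_t f t y * ?e y)) (at t)"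
  proof (rule has_vector_derivative_integral)
    show "integrable lborel (\<lambda>y. f s y * ?e y)" for s
      by (rule schwartz_mult_integrable[OF f iexp_measurable]) simp
    show "((\<lambda>s. f s y * ?e y) has_vector_derivative D_t f s y * ?e y) (at s)" for s y
      by (intro has_vector_derivative_mult_left schwartz_has_D_t f)
    show "norm (D_t f s y * ?e y) \<le> 2 * schwartz_seminorm 2 (D_t f) * inverse (1 + y\<^sup>2)" for s y
      using schwartz_decay[OF Df, of s y] by (simp add: norm_mult)
    show "integrable lborel (\<lambda>y. 2 * schwartz_seminorm 2 (D_t f) * inverse (1 + y\<^sup>2))"
      by (intro integrable_mult_right integrable_inverse_1_plus_square')
    show "(\<lambda>y. D_t f t y * ?e y) \<in> borel_measurable lborel"
      using schwartz_slice_measurable[OF Df] iexp_measurable by simp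
  qed
  from has_vector_derivative_mult_right[OF this] show ?thesis
    unfolding inv_fourier_def .
qed

lemma inv_fourier_D_x:
  assumes f: "f \<in> schwartz"
  shows "(inv_fourier f t has_vector_derivative inv_fourier (\<lambda>t y. \<i> * (of_real y * f t y)) t x) (at x)"
proof -
  let ?g = "\<lambda>t y. of_real y * f t y"
  have g: "?g \<in> schwartz"
    using f by (rule bounded_op_schwartz[OF bounded_op_mult_x])
  let ?e = "\<lambda>x y. exp (\<i> * of_real x * complex_of_real y)"
  have "((\<lambda>x. LINT y|lborel. f t y * ?e x y) has_vector_derivative (LINT y|lborel. \<i> * ?g t y * ?e x y)) (at x)"
  proof (rule has_vector_derivative_integral)
    show "integrable lborel (\<lambda>y. f t y * ?e x y)" for x
      by (rule schwartz_mult_integrable[OF f iexp_measurable]) simp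
    show "((\<lambda>x. f t y * ?e x y) has_vector_derivative \<i> * ?g t y * ?e x y) (at x)" for x y
      by (rule has_vector_derivative_real_field) (auto intro!: derivative_eq_intros)
    show "norm (\<i> * ?g t y * ?e x y) \<le> 2 * schwartz_seminorm 2 ?g * inverse (1 + y\<^sup>2)" for x y
      using schwartz_decay[OF g, where t = t and x = y] by (simp add: norm_mult)
    show "integrable lborel (\<lambda>y. 2 * schwartz_seminorm 2 ?g * inverse (1 + y\<^sup>2))"
      by (intro integrable_mult_right integrable_inverse_1_plus_square')
    show "(\<lambda>y. \<i> * ?g t y * ?e x y) \<in> borel_measurable lborel"
      using schwartz_slice_measurable[OF f, of t] iexp_measurable[of x] by simp
  qed
  from has_vector_derivative_mult_right[OF this] show ?thesis
    unfolding inv_fourier_def .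
qed

text \<open>
  Integration by parts: the integral over the line of the derivative of \<open>y \<mapsto> f t y * exp (i x y)\<close> is \<open>0\<close>,
  because \<open>f t\<close> vanishes at both ends.
\<close>

lemma inv_fourier_mult_x:
  assumes f: "f \<in> schwartz"
  shows "of_real x * inv_fourier f t x = inv_fourier (\<lambda>t y. \<i> * D_x f t y) t x"
proof -
  have Df: "D_x f \<in> schwartz"
    using f by (rule bounded_op_schwartz[OF bounded_op_D_x])
  let ?e = "\<lambda>y. exp (\<i> * of_real x * complex_of_real y)"
  let ?F' = "\<lambda>y. f t y * (\<i> * of_real x * ?e y) + D_x f t y * ?e y"
  have int: "integrable lborel (\<lambda>y. f t y * ?e y)" "integrable lborel (\<lambda>y. D_x f t y * ?e y)"
    by (rule schwartz_mult_integrable[OF _ iexp_measurable]; simp add: f Df)+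
  have int1: "integrable lborel (\<lambda>y. f t y * (\<i> * of_real x * ?e y))"
    using integrable_mult_right[OF int(1), of "\<i> * of_real x"] by (simp add: algebra_simps)
  have "(LBINT y=-\<infinity>..\<infinity>. ?F' y) = 0 - 0"
  proof (rule interval_integral_FTC_integrable)
    show "((\<lambda>y. f t y * ?e y) has_vector_derivative ?F' y) (at y)" for y
      by (intro has_vector_derivative_mult schwartz_has_D_x f has_vector_derivative_real_field)
         (auto intro!: derivative_eq_intros)
    have "continuous_on UNIV ?F'"
      by (intro continuous_intros schwartz_slice_continuous f Df)
    then show "isCont ?F' y" for y
      by (simp add: continuous_on_eq_continuous_at)
    show "set_integrable lborel (einterval (-\<infinity>) \<infinity>) ?F'"
      using Bochner_Integration.integrable_add[OF int1 int(2)] by (simp add: set_integrable_def einterval_def)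
    show "(((\<lambda>y. f t y * ?e y) \<circ> real_of_ereal) \<longlongrightarrow> 0) (at_right (-\<infinity>))"
      unfolding ereal_tendsto_simps
      by (rule tendsto_norm_zero_cancel)
         (use tendsto_norm_zero[OF schwartz_slice_tendsto_0(2)[OF f]] in \<open>simp add: norm_mult\<close>)
    show "(((\<lambda>y. f t y * ?e y) \<circ> real_of_ereal) \<longlongrightarrow> 0) (at_left \<infinity>)"
      unfolding ereal_tendsto_simps
      by (rule tendsto_norm_zero_cancel)
         (use tendsto_norm_zero[OF schwartz_slice_tendsto_0(1)[OF f]] in \<open>simp add: norm_mult\<close>)
  qed simp
  then have "(LINT y|lborel. ?F' y) = 0"
    by (simp add: interval_lebesgue_integral_def set_lebesgue_integral_def einterval_def)
  then have "(LINT y|lborel. f t y * (\<i> * of_real x * ?e y)) + (LINT y|lborel. D_x f t y * ?e y) = 0"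
    by (simp add: Bochner_Integration.integral_add[OF int1 int(2)])
  moreover have "(LINT y|lborel. f t y * (\<i> * of_real x * ?e y)) = \<i> * of_real x * (LINT y|lborel. f t y * ?e y)"
    by (subst integral_mult_right_zero[symmetric]) (simp add: algebra_simps)
  ultimately have "(LINT y|lborel. D_x f t y * ?e y) = - (\<i> * of_real x * (LINT y|lborel. f t y * ?e y))"
    by (metis add.inverse_unique)
  then have "\<i> * (LINT y|lborel. D_x f t y * ?e y) = of_real x * (LINT y|lborel. f t y * ?e y)"
    by (simp flip: mult.assoc)
  moreover have "(LINT y|lborel. \<i> * D_x f t y * ?e y) = \<i> * (LINT y|lborel. D_x f t y * ?e y)"
    by (subst integral_mult_right_zero[symmetric]) (simp add: algebra_simps)
  ultimately show ?thesis
    by (simp add: inv_fourier_def)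
qed

lemma inv_fourier_bound:
  assumes f: "f \<in> schwartz"
  shows "norm (inv_fourier f t x) \<le> schwartz_seminorm 2 f * (LINT y|lborel. inverse (1 + y\<^sup>2))"
proof -
  let ?e = "\<lambda>y. exp (\<i> * of_real x * complex_of_real y)"
  have "norm (LINT y|lborel. f t y * ?e y) \<le> (LINT y|lborel. 2 * schwartz_seminorm 2 f * inverse (1 + y\<^sup>2))"
  proof (rule Bochner_Integration.integral_norm_bound_integral)
    show "integrable lborel (\<lambda>y. f t y * ?e y)"
      by (rule schwartz_mult_integrable[OF f iexp_measurable]) simp
    show "integrable lborel (\<lambda>y. 2 * schwartz_seminorm 2 f * inverse (1 + y\<^sup>2))"
      by (intro integrable_mult_right integrable_inverse_1_plus_square')
    show "norm (f t y * ?e y) \<le> 2 * schwartz_seminorm 2 f * inverse (1 + y\<^sup>2)" for y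
      using schwartz_decay[OF f, of t y] by (simp add: norm_mult)
  qed
  then have *: "norm (LINT y|lborel. f t y * ?e y) \<le> 2 * (schwartz_seminorm 2 f * (LINT y|lborel. inverse (1 + y\<^sup>2)))"
    by simp
  have "norm (inv_fourier f t x) = 1 / (2 * pi) * norm (LINT y|lborel. f t y * ?e y)"
    by (simp add: inv_fourier_def norm_mult norm_divide)
  also have "\<dots> \<le> 1 / 2 * norm (LINT y|lborel. f t y * ?e y)"
    using pi_ge_two by (intro mult_right_mono) (auto simp: field_simps)
  finally show ?thesis
    using * by simp
qed

lemma inv_fourier_continuous:
  assumes f: "f \<in> schwartz"
  shows "continuous_on UNIV (\<lambda>(t, x). inv_fourier f t x)"
proof (rule continuous_at_imp_continuous_on, intro ballI continuous_at_sequentiallyI)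
  fix p :: "real \<times> real" and X assume X: "X \<longlonglongrightarrow> p"
  let ?h = "\<lambda>p y. f (fst p) y * exp (\<i> * of_real (snd p) * complex_of_real y)"
  have "(\<lambda>n. LINT y|lborel. ?h (X n) y) \<longlonglongrightarrow> (LINT y|lborel. ?h p y)"
  proof (rule integral_dominated_convergence)
    show "integrable lborel (\<lambda>y. 2 * schwartz_seminorm 2 f * inverse (1 + y\<^sup>2))"
      by (intro integrable_mult_right integrable_inverse_1_plus_square')
    show "?h p \<in> borel_measurable lborel" "?h (X n) \<in> borel_measurable lborel" for n
      using schwartz_slice_measurable[OF f] iexp_measurable by simp_all
    show "AE y in lborel. norm (?h (X n) y) \<le> 2 * schwartz_seminorm 2 f * inverse (1 + y\<^sup>2)" for n
      using schwartz_decay[OF f] by (simp add: norm_mult)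
    have "continuous_on UNIV (\<lambda>p. ?h p y)" for y
      by (intro continuous_intros smooth_cylinder_continuous_compose[OF schwartz_smooth[OF f]])
    then have "(\<lambda>n. ?h (X n) y) \<longlonglongrightarrow> ?h p y" for y
      by (rule continuous_on_tendsto_compose[OF _ X]) auto
    then show "AE y in lborel. (\<lambda>n. ?h (X n) y) \<longlonglongrightarrow> ?h p y"
      by simp
  qed
  from tendsto_mult_left[OF this, of "1 / (2 * of_real pi)"]
  show "(\<lambda>n. case X n of (t, x) \<Rightarrow> inv_fourier f t x) \<longlonglongrightarrow> (case p of (t, x) \<Rightarrow> inv_fourier f t x)"
    by (simp add: inv_fourier_def case_prod_unfold)
qed

text \<open>
  Composing the transform with all bounded operators gives a family closed under \<open>\<partial>\<^sub>t\<close>, \<open>\<partial>\<^sub>x\<close> and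
  multiplication by \<open>x\<close>, since the transform commutes with the first and exchanges the other two.
\<close>

lemma bounded_op_inv_fourier: "bounded_op inv_fourier"
proof -
  define \<F> where "\<F> = {\<lambda>f. inv_fourier (T f) | T. bounded_op T}"
  have sums: "(\<lambda>f. inv_fourier (T f)) \<in> op_sums \<F>" if "bounded_op T" for T
    using that by (intro op_sums.base) (auto simp: \<F>_def)
  have "bounded_op T" if "T \<in> \<F>" for T
    using _ _ _ _ _ _ that
  proof (rule bounded_op_coinduct)
    fix T f assume "T \<in> \<F>" and f: "f \<in> schwartz"
    then obtain U where T: "T = (\<lambda>f. inv_fourier (U f))" and U: "bounded_op U"
      by (auto simp: \<F>_def)
    have Uf: "U f \<in> schwartz"
      using U f by (rule bounded_op_schwartz)
    show "continuous_on UNIV (\<lambda>(t, x). T f t x)"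
      unfolding T by (rule inv_fourier_continuous[OF Uf])
    show "T f (t + 2 * pi) x = T f t x" for t x
      by (simp add: T inv_fourier_def schwartz_periodic[OF Uf])
  next
    fix T assume "T \<in> \<F>"
    then obtain U where T: "T = (\<lambda>f. inv_fourier (U f))" and U: "bounded_op U"
      by (auto simp: \<F>_def)
    have Uf: "U f \<in> schwartz" if "f \<in> schwartz" for f
      using U that by (rule bounded_op_schwartz)
    let ?I = "LINT y|lborel. inverse (1 + y\<^sup>2) :: real"
    obtain M C where MC: "\<forall>f\<in>schwartz. schwartz_seminorm 2 (U f) \<le> C * schwartz_seminorm M f"
      using bounded_op_seminorm[OF U] by blast
    have "norm (T f t x) \<le> C * ?I * schwartz_seminorm M f" if f: "f \<in> schwartz" for f t x
    proof -
      have "norm (T f t x) \<le> schwartz_seminorm 2 (U f) * ?I"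
        unfolding T by (rule inv_fourier_bound[OF Uf[OF f]])
      also have "\<dots> \<le> C * schwartz_seminorm M f * ?I"
        using MC f by (intro mult_right_mono integral_nonneg) auto
      finally show ?thesis by (simp add: algebra_simps)
    qed
    then show "\<exists>M C. \<forall>f\<in>schwartz. \<forall>t x. norm (T f t x) \<le> C * schwartz_seminorm M f"
      by blast
    show "\<exists>U\<in>op_sums \<F>. \<forall>f\<in>schwartz. \<forall>t x. ((\<lambda>s. T f s x) has_vector_derivative U f t x) (at t)"
      using inv_fourier_D_t[OF Uf] unfolding T
      by (intro bexI[OF _ sums[OF bounded_op_compose[OF bounded_op_D_t U]]]) blast
    show "\<exists>U\<in>op_sums \<F>. \<forall>f\<in>schwartz. \<forall>t x. (T f t has_vector_derivative U f t x) (at x)"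
      using inv_fourier_D_x[OF Uf] unfolding T
      by (intro bexI[OF _ sums[OF bounded_op_compose[OF bounded_op_scale
            bounded_op_compose[OF bounded_op_mult_x U]]]]) blast
    show "\<exists>U\<in>op_sums \<F>. \<forall>f\<in>schwartz. \<forall>t x. of_real x * T f t x = U f t x"
      using inv_fourier_mult_x[OF Uf] unfolding T
      by (intro bexI[OF _ sums[OF bounded_op_compose[OF bounded_op_scale
            bounded_op_compose[OF bounded_op_D_x U]]]]) blast
  qed
  moreover have "inv_fourier \<in> \<F>"
    using bounded_op_id by (auto simp: \<F>_def)
  ultimately show ?thesis by blast
qed

subsection \<open>Fourier inversion\<close>

lemma std_normal_transform:
  "(LINT z|lborel. of_real (std_normal_density z) * exp (\<i> * of_real s * of_real z)) =
    complex_of_real (exp (- (s\<^sup>2) / 2))"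
proof -
  have "char std_normal_distribution s =
      (LINT z|lborel. of_real (std_normal_density z) * exp (\<i> * of_real s * of_real z))"
    unfolding char_def
    by (subst integral_density) (auto simp: scaleR_conv_of_real mult.assoc)
  then show ?thesis
    by (simp add: char_std_normal_distribution)
qed

text \<open>
  Insert the factor \<open>K n \<xi> = exp (- (\<xi> / (n + 1))\<^sup>2 / 2)\<close>, which tends to \<open>1\<close>. With it the double integral
  converges absolutely, and exchanging the order of integration leaves \<open>2 \<pi>\<close> times the mean of
  \<open>f (x + Z / (n + 1))\<close> for a standard normal \<open>Z\<close>, since Gaussians are transformed to Gaussians. As
  \<open>n \<rightarrow> \<infinity>\<close>, the mean tends to \<open>f x\<close> by continuity and boundedness, and the regularised integral tends to
  the original one because \<open>g\<close> is integrable.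
\<close>

lemma fourier_inversion:
  fixes f g :: "real \<Rightarrow> complex"
  assumes f: "integrable lborel f" "continuous_on UNIV f" "\<And>y. norm (f y) \<le> C"
    and g_def: "\<And>\<xi>. g \<xi> = (LINT y|lborel. f y * exp (\<i> * of_real y * of_real \<xi>))"
    and g: "integrable lborel g"
  shows "(LINT \<xi>|lborel. g \<xi> * exp (- \<i> * of_real x * of_real \<xi>)) = 2 * of_real pi * f x"
proof -
  let ?\<phi> = "\<lambda>z. complex_of_real (std_normal_density z)"
  let ?e = "\<lambda>s::real. exp (\<i> * of_real s)"
  have \<phi>_int: "integrable lborel ?\<phi>"
    by (intro integrable_of_real) auto
  have \<phi>_eq: "complex_of_real (sqrt (2 * pi)) * ?\<phi> z = of_real (exp (- z\<^sup>2 / 2))" for z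
  proof -
    have "sqrt (2 * pi) * std_normal_density z = exp (- z\<^sup>2 / 2)"
      by (simp add: std_normal_density_def)
    then show ?thesis by (metis of_real_mult)
  qed
  have f_meas: "f \<in> borel_measurable borel"
    using f(1) by auto
  define K where "K n \<xi> = complex_of_real (sqrt (2 * pi)) * ?\<phi> (\<xi> / real (Suc n))" for n \<xi>
  have K_int: "integrable lborel (K n)" for n
  proof -
    have "integrable lborel (\<lambda>\<xi>. ?\<phi> (0 + (1 / real (Suc n)) * \<xi>))"
      by (rule lborel_integrable_real_affine[OF \<phi>_int]) simp
    then show ?thesis
      unfolding K_def by (intro integrable_mult_right) (simp add: field_simps)
  qed
  have K_meas: "K n \<in> borel_measurable borel" for n
    using K_int[of n] by auto

  have "(\<lambda>n. LINT \<xi>|lborel. g \<xi> * ?e (- x * \<xi>) * K n \<xi>) \<longlonglongrightarrow> (LINT \<xi>|lborel. g \<xi> * ?e (- x * \<xi>))"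
  proof (rule integral_dominated_convergence[where w = "\<lambda>\<xi>. norm (g \<xi>)"])
    have e: "(\<lambda>\<xi>. ?e (- x * \<xi>)) \<in> borel_measurable borel"
      by (intro borel_measurable_continuous_onI continuous_intros)
    show "(\<lambda>\<xi>. g \<xi> * ?e (- x * \<xi>)) \<in> borel_measurable lborel"
      "(\<lambda>\<xi>. g \<xi> * ?e (- x * \<xi>) * K n \<xi>) \<in> borel_measurable lborel" for n
      using e g K_meas[of n] by auto
    show "integrable lborel (\<lambda>\<xi>. norm (g \<xi>))"
      using g by simp
    have "norm (K n \<xi>) \<le> 1" for n \<xi>
      unfolding K_def \<phi>_eq by simp
    then show "AE \<xi> in lborel. norm (g \<xi> * ?e (- x * \<xi>) * K n \<xi>) \<le> norm (g \<xi>)" for n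
      by (simp add: norm_mult mult_left_le)
    have "(\<lambda>n. K n \<xi>) \<longlonglongrightarrow> 1" for \<xi>
    proof -
      have "(\<lambda>n. \<xi> / real (Suc n)) \<longlonglongrightarrow> 0"
        by (intro tendsto_divide_0[OF tendsto_const] filterlim_at_top_imp_at_infinity
            filterlim_compose[OF filterlim_real_sequentially filterlim_Suc])
      then have "(\<lambda>n. complex_of_real (exp (- (\<xi> / real (Suc n))\<^sup>2 / 2))) \<longlonglongrightarrow> of_real (exp (- 0\<^sup>2 / 2))"
        by (intro tendsto_intros) auto
      then show ?thesis
        unfolding K_def \<phi>_eq by simp
    qed
    then have "(\<lambda>n. g \<xi> * ?e (- x * \<xi>) * K n \<xi>) \<longlonglongrightarrow> g \<xi> * ?e (- x * \<xi>) * 1" for \<xi>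
      by (rule tendsto_mult_left)
    then show "AE \<xi> in lborel. (\<lambda>n. g \<xi> * ?e (- x * \<xi>) * K n \<xi>) \<longlonglongrightarrow> g \<xi> * ?e (- x * \<xi>)"
      by simp
  qed
  moreover have "(LINT \<xi>|lborel. g \<xi> * ?e (- x * \<xi>) * K n \<xi>) =
      2 * of_real pi * (LINT z|lborel. f (x + z / real (Suc n)) * ?\<phi> z)" for n
  proof -
    let ?F = "\<lambda>y \<xi>. f y * K n \<xi> * ?e ((y - x) * \<xi>)"
    have F_int: "integrable (lborel \<Otimes>\<^sub>M lborel) (\<lambda>(y, \<xi>). ?F y \<xi>)"
    proof (rule lborel_pair.Fubini_integrable)
      have "(\<lambda>p. ?e ((fst p - x) * snd p)) \<in> borel_measurable (borel :: (real \<times> real) measure)"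
        by (intro borel_measurable_continuous_onI continuous_intros)
      then have e: "(\<lambda>p. ?e ((fst p - x) * snd p)) \<in> borel_measurable (lborel \<Otimes>\<^sub>M lborel)"
        by (simp add: lborel_prod)
      show "(\<lambda>(y, \<xi>). ?F y \<xi>) \<in> borel_measurable (lborel \<Otimes>\<^sub>M lborel)"
        using e f_meas K_meas[of n] unfolding case_prod_unfold by measurable
      have "norm (?F y \<xi>) = norm (f y) * norm (K n \<xi>)" for y \<xi>
        by (simp add: norm_mult)
      then show "integrable lborel (\<lambda>y. LINT \<xi>|lborel. norm (case (y, \<xi>) of (y, \<xi>) \<Rightarrow> ?F y \<xi>))"
        using f(1) by simp
      have "integrable lborel (\<lambda>\<xi>. f y * K n \<xi> * ?e ((y - x) * \<xi>))" for y
      proof (rule Bochner_Integration.integrable_bound[OF integrable_mult_right[OF K_int[of n], of "f y"]])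
        show "(\<lambda>\<xi>. ?F y \<xi>) \<in> borel_measurable lborel"
          using K_meas[of n] by (intro borel_measurable_times borel_measurable_continuous_onI continuous_intros) auto
      qed (simp add: norm_mult)
      then show "AE y in lborel. integrable lborel (\<lambda>\<xi>. case (y, \<xi>) of (y, \<xi>) \<Rightarrow> ?F y \<xi>)"
        by simp
    qed
    have "(LINT \<xi>|lborel. g \<xi> * ?e (- x * \<xi>) * K n \<xi>) = (LINT \<xi>|lborel. LINT y|lborel. ?F y \<xi>)"
    proof (rule Bochner_Integration.integral_cong[OF refl])
      fix \<xi>
      have "g \<xi> * ?e (- x * \<xi>) * K n \<xi> =
          (LINT y|lborel. f y * exp (\<i> * of_real y * of_real \<xi>) * (?e (- x * \<xi>) * K n \<xi>))"
        unfolding g_def by simp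
      also have "\<dots> = (LINT y|lborel. ?F y \<xi>)"
      proof (rule Bochner_Integration.integral_cong[OF refl])
        fix y
        have "exp (\<i> * of_real y * of_real \<xi>) * ?e (- x * \<xi>) = ?e ((y - x) * \<xi>)"
          by (simp add: algebra_simps flip: exp_add)
        then show "f y * exp (\<i> * of_real y * of_real \<xi>) * (?e (- x * \<xi>) * K n \<xi>) = ?F y \<xi>"
          by (simp add: algebra_simps)
      qed
      finally show "g \<xi> * ?e (- x * \<xi>) * K n \<xi> = (LINT y|lborel. ?F y \<xi>)" .
    qed
    also have "\<dots> = (LINT y|lborel. LINT \<xi>|lborel. ?F y \<xi>)"
      by (rule lborel_pair.Fubini_integral[OF F_int])
    also have "\<dots> = (LINT y|lborel. 2 * of_real pi * (real (Suc n) *\<^sub>R (f y * ?\<phi> (real (Suc n) * (y - x)))))"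
    proof (rule Bochner_Integration.integral_cong[OF refl])
      fix y
      let ?N = "real (Suc n)"
      \<comment> \<open>substitute \<open>\<xi> = ?N * z\<close>, which turns \<open>K n\<close> into the standard Gaussian\<close>
      have "(LINT \<xi>|lborel. ?F y \<xi>) = \<bar>?N\<bar> *\<^sub>R (LINT z|lborel. ?F y (0 + ?N * z))"
        by (rule lborel_integral_real_affine) simp
      also have "(\<lambda>z. ?F y (0 + ?N * z)) = (\<lambda>z. of_real (sqrt (2 * pi)) * f y *
          (?\<phi> z * exp (\<i> * of_real (?N * (y - x)) * of_real z)))"
      proof
        fix z
        have "K n (0 + ?N * z) = of_real (sqrt (2 * pi)) * ?\<phi> z"
          by (simp add: K_def del: of_nat_Suc)
        then show "?F y (0 + ?N * z) = of_real (sqrt (2 * pi)) * f y *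
            (?\<phi> z * exp (\<i> * of_real (?N * (y - x)) * of_real z))"
          by (simp only:) (simp add: algebra_simps)
      qed
      also have "(LINT z|lborel. of_real (sqrt (2 * pi)) * f y *
          (?\<phi> z * exp (\<i> * of_real (?N * (y - x)) * of_real z))) =
          of_real (sqrt (2 * pi)) * f y * of_real (exp (- (?N * (y - x))\<^sup>2 / 2))"
        by (simp only: integral_mult_right_zero std_normal_transform)
      also have "\<dots> = of_real (sqrt (2 * pi)) * f y * (of_real (sqrt (2 * pi)) * ?\<phi> (?N * (y - x)))"
        by (simp only: \<phi>_eq)
      also have "\<dots> = 2 * of_real pi * (f y * ?\<phi> (?N * (y - x)))"
      proof -
        have "complex_of_real (sqrt (2 * pi) * sqrt (2 * pi)) = of_real (2 * pi)"
          by (simp del: of_real_mult)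
        then have "complex_of_real (sqrt (2 * pi)) * of_real (sqrt (2 * pi)) = 2 * of_real pi"
          by (simp only: of_real_mult of_real_numeral)
        then have "f y * ?\<phi> (?N * (y - x)) * (complex_of_real (sqrt (2 * pi)) * of_real (sqrt (2 * pi))) =
            f y * ?\<phi> (?N * (y - x)) * (2 * of_real pi)"
          by (simp only:)
        then show ?thesis by (simp only: ac_simps)
      qed
      finally show "(LINT \<xi>|lborel. ?F y \<xi>) = 2 * of_real pi * (?N *\<^sub>R (f y * ?\<phi> (?N * (y - x))))"
        by (simp add: scaleR_conv_of_real)
    qed
    also have "\<dots> = 2 * of_real pi * (real (Suc n) *\<^sub>R (LINT y|lborel. f y * ?\<phi> (real (Suc n) * (y - x))))"
      by (simp only: integral_mult_right_zero integral_scaleR_right)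
    \<comment> \<open>substitute \<open>y = x + z / (n + 1)\<close>; the Jacobian cancels the factor \<open>n + 1\<close>\<close>
    also have "(LINT y|lborel. f y * ?\<phi> (real (Suc n) * (y - x))) =
        \<bar>1 / real (Suc n)\<bar> *\<^sub>R (LINT z|lborel. f (x + 1 / real (Suc n) * z) *
          ?\<phi> (real (Suc n) * (x + 1 / real (Suc n) * z - x)))"
      by (rule lborel_integral_real_affine) simp
    finally show ?thesis
      by simp
  qed
  ultimately have 1: "(\<lambda>n. 2 * of_real pi * (LINT z|lborel. f (x + z / real (Suc n)) * ?\<phi> z))
      \<longlonglongrightarrow> (LINT \<xi>|lborel. g \<xi> * ?e (- x * \<xi>))"
    by simp
  have "(\<lambda>n. LINT z|lborel. f (x + z / real (Suc n)) * ?\<phi> z) \<longlonglongrightarrow> (LINT z|lborel. f x * ?\<phi> z)"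
  proof (rule integral_dominated_convergence)
    show "integrable lborel (\<lambda>z. C * std_normal_density z)"
      by simp
    show "(\<lambda>z. f x * ?\<phi> z) \<in> borel_measurable lborel"
      by simp
    show "(\<lambda>z. f (x + z / real (Suc n)) * ?\<phi> z) \<in> borel_measurable lborel" for n
      using f_meas by simp
    show "AE z in lborel. norm (f (x + z / real (Suc n)) * ?\<phi> z) \<le> C * std_normal_density z" for n
      using f(3) by (intro AE_I2) (simp add: norm_mult mult_right_mono)
    have "(\<lambda>n. f (x + z / real (Suc n))) \<longlonglongrightarrow> f x" for z
    proof (rule continuous_on_tendsto_compose[OF f(2)])
      have "(\<lambda>n. z / real (Suc n)) \<longlonglongrightarrow> 0"
        by (intro tendsto_divide_0[OF tendsto_const] filterlim_at_top_imp_at_infinity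
            filterlim_compose[OF filterlim_real_sequentially filterlim_Suc])
      from tendsto_add[OF tendsto_const[of x] this] show "(\<lambda>n. x + z / real (Suc n)) \<longlonglongrightarrow> x"
        by simp
    qed auto
    then show "AE z in lborel. (\<lambda>n. f (x + z / real (Suc n)) * ?\<phi> z) \<longlonglongrightarrow> f x * ?\<phi> z"
      by (intro AE_I2 tendsto_mult tendsto_const)
  qed
  moreover have "(LINT z|lborel. f x * ?\<phi> z) = f x"
    by simp
  ultimately have "(\<lambda>n. 2 * of_real pi * (LINT z|lborel. f (x + z / real (Suc n)) * ?\<phi> z)) \<longlonglongrightarrow> 2 * of_real pi * f x"
    by (intro tendsto_mult_left) simp
  from LIMSEQ_unique[OF 1 this] show ?thesis
    by (simp add: mult.assoc)
qed

text \<open>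
  Modulating by \<open>exp (i \<xi> A(t))\<close> shifts the point at which the inversion formula is evaluated from \<open>x\<close>
  to \<open>x - A(t)\<close>.
\<close>

lemma fourier_modulated_inv_fourier:
  assumes f: "f \<in> schwartz"
  shows "fourier (\<lambda>t \<xi>. exp (\<i> * of_real \<xi> * of_real (A t)) * inv_fourier f t \<xi>) = (\<lambda>t x. f t (x - A t))"
proof (intro ext)
  fix t x
  let ?g = "\<lambda>\<xi>. LINT y|lborel. f t y * exp (\<i> * of_real y * complex_of_real \<xi>)"
  have inv: "inv_fourier f t \<xi> = 1 / (2 * of_real pi) * ?g \<xi>" for \<xi>
    by (simp add: inv_fourier_def mult.commute mult.left_commute)
  then have g: "?g = (\<lambda>\<xi>. 2 * of_real pi * inv_fourier f t \<xi>)"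
    by auto
  have "integrable lborel ?g"
    unfolding g
    by (intro integrable_mult_right schwartz_slice_integrable bounded_op_schwartz[OF bounded_op_inv_fourier] f)
  moreover have "norm (f t y) \<le> schwartz_norm 0 0 0 f" for y
    using weighted_deriv_le_schwartz_norm[OF f, of 0 0 0 "(t, y)"] by (simp add: weighted_deriv_def)
  ultimately have "(LINT \<xi>|lborel. ?g \<xi> * exp (- \<i> * of_real (x - A t) * of_real \<xi>)) = 2 * of_real pi * f t (x - A t)"
    by (intro fourier_inversion[OF schwartz_slice_integrable[OF f] schwartz_slice_continuous[OF f] _ refl])
  moreover have "fourier (\<lambda>t \<xi>. exp (\<i> * of_real \<xi> * of_real (A t)) * inv_fourier f t \<xi>) t x =
      (LINT \<xi>|lborel. 1 / (2 * of_real pi) * (?g \<xi> * exp (- \<i> * of_real (x - A t) * of_real \<xi>)))"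
    unfolding fourier_def
  proof (rule Bochner_Integration.integral_cong[OF refl])
    fix \<xi>
    have e: "exp (\<i> * of_real \<xi> * of_real (A t)) * exp (- \<i> * of_real \<xi> * of_real x) =
        exp (- \<i> * of_real (x - A t) * complex_of_real \<xi>)"
      by (simp add: algebra_simps flip: exp_add)
    then show "exp (\<i> * of_real \<xi> * of_real (A t)) * inv_fourier f t \<xi> * exp (- \<i> * of_real \<xi> * of_real x) =
        1 / (2 * of_real pi) * (?g \<xi> * exp (- \<i> * of_real (x - A t) * of_real \<xi>))"
      unfolding inv e[symmetric] by (simp only: ac_simps)
  qed
  ultimately show "fourier (\<lambda>t \<xi>. exp (\<i> * of_real \<xi> * of_real (A t)) * inv_fourier f t \<xi>) t x = f t (x - A t)"
    by simp
qed

section \<open>Transport operators and their conjugation\<close>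

lemma transposed_transposed:
  "(\<And>f. f \<in> schwartz \<Longrightarrow> T f \<in> schwartz) \<Longrightarrow> transposed T (transposed U u) = transposed (\<lambda>f. U (T f)) u"
  by (auto simp: transposed_def)

lemma transposed_cong:
  "(\<And>f. f \<in> schwartz \<Longrightarrow> T f = U f) \<Longrightarrow> transposed T u = transposed U u"
  by (auto simp: transposed_def)

lemma transposed_id: "u \<in> extensional schwartz \<Longrightarrow> transposed (\<lambda>f. f) u = u"
  unfolding transposed_def by (rule extensional_restrict)

lemma tempered_extensional: "u \<in> tempered \<Longrightarrow> u \<in> extensional schwartz"
  by (simp add: tempered_def)

lemma regular_dist_extensional: "regular_dist g \<in> extensional schwartz"
  by (simp add: regular_dist_def)

lemma tempered_add:
  "u \<in> tempered \<Longrightarrow> f \<in> schwartz \<Longrightarrow> g \<in> schwartz \<Longrightarrow> u (\<lambda>t x. f t x + g t x) = u f + u g"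
  by (simp add: tempered_def)

lemma tempered_scale:
  "u \<in> tempered \<Longrightarrow> f \<in> schwartz \<Longrightarrow> u (\<lambda>t x. c * f t x) = c * u f"
  by (simp add: tempered_def)

subsection \<open>The formal transpose of a transport operator\<close>

text \<open>
  The transpose of \<open>\<partial>\<^sub>t + a \<partial>\<^sub>x + q\<close> has no zeroth-order term coming from \<open>a\<close>, because \<open>a\<close> depends on \<open>t\<close> only.
\<close>

definition transport_adjoint :: "(real \<Rightarrow> real) \<Rightarrow> (real \<Rightarrow> complex) \<Rightarrow> cylfun \<Rightarrow> cylfun" where
  "transport_adjoint a q f = (\<lambda>t x. - D_t f t x - of_real (a t) * D_x f t x + q t * f t x)"

lemma transport_adjoint_alt:
  "transport_adjoint a q f =
     (\<lambda>t x. (- 1 * D_t f t x + (- 1 * of_real (a t)) * D_x f t x) + q t * f t x)"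
  by (simp add: transport_adjoint_def)

lemma bounded_op_transport_adjoint:
  assumes "a \<in> smooth_circle" "q \<in> smooth_circle"
  shows "bounded_op (transport_adjoint a q)"
  unfolding transport_adjoint_alt[abs_def]
  by (intro bounded_op_add bounded_op_mult assms
      bounded_op_compose[OF bounded_op_scale bounded_op_D_t]
      bounded_op_compose[OF bounded_op_mult bounded_op_D_x]
      smooth_circle_mult smooth_circle_const smooth_circle_of_real)

lemma linear_op_transport_adjoint: "linear_op (transport_adjoint a q)"
  unfolding linear_op_def transport_adjoint_def
  by (auto simp: D_t_add D_x_add D_t_scale D_x_scale schwartz_smooth algebra_simps)

lemma D_x_mult_t:
  assumes "f \<in> smooth_cylinder"
  shows "D_x (\<lambda>t x. m t * f t x) = (\<lambda>t x. m t * D_x f t x)"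
  unfolding D_x_def[of "\<lambda>t x. m t * f t x"]
  using has_vector_derivative_mult_right[OF smooth_cylinder_has_D_x[OF assms]]
  by (auto intro!: ext vector_derivative_at)

lemma transport_op_eq_transposed:
  assumes a: "a \<in> smooth_circle" and q: "q \<in> smooth_circle" and u: "u \<in> tempered"
  shows "transport_op a q u = transposed (transport_adjoint a q) u"
proof
  fix f
  show "transport_op a q u f = transposed (transport_adjoint a q) u f"
  proof (cases "f \<in> schwartz")
    case f: True
    have Dtf: "D_t f \<in> schwartz" and Dxf: "D_x f \<in> schwartz"
      using f by (rule bounded_op_schwartz[OF bounded_op_D_t], rule bounded_op_schwartz[OF bounded_op_D_x])
    have mult: "(\<lambda>t x. m t * g t x) \<in> schwartz" if "m \<in> smooth_circle" "g \<in> schwartz" for m g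
      using bounded_op_schwartz[OF bounded_op_mult[OF that(1)] that(2)] .
    note af = mult[OF smooth_circle_of_real[OF a] f] and aDxf = mult[OF smooth_circle_of_real[OF a] Dxf]
      and qf = mult[OF q f]
    have "transport_op a q u f =
        - u (D_t f) - u (\<lambda>t x. of_real (a t) * D_x f t x) + u (\<lambda>t x. q t * f t x)"
      using f af by (simp add: transport_op_def dist_add_def dist_D_t_def dist_mult_def dist_D_x_def
          D_x_mult_t[OF schwartz_smooth[OF f]])
    also have "\<dots> = - 1 * u (D_t f) + - 1 * u (\<lambda>t x. of_real (a t) * D_x f t x) + u (\<lambda>t x. q t * f t x)"
      by simp
    also have "\<dots> = u (\<lambda>t x. (- 1 * D_t f t x + - 1 * (of_real (a t) * D_x f t x)) + q t * f t x)"
      using Dtf aDxf qf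
      by (simp only: tempered_add[OF u] tempered_scale[OF u] schwartz_add schwartz_scale)
    finally show ?thesis
      using f by (simp add: transposed_def transport_adjoint_def)
  qed (simp add: transport_op_def dist_add_def transposed_def)
qed

subsection \<open>The conjugation as a weighted shear\<close>

definition weighted_shear :: "(real \<Rightarrow> complex) \<Rightarrow> (real \<Rightarrow> real) \<Rightarrow> cylfun \<Rightarrow> cylfun" where
  "weighted_shear m A f = (\<lambda>t x. m t * f t (x - A t))"

lemma weighted_shear_twisted: "weighted_shear m A = twisted_shear m (\<lambda>_. 0) A"
  by (simp add: weighted_shear_def[abs_def] twisted_shear_def[abs_def])

lemma bounded_op_weighted_shear:
  "m \<in> smooth_circle \<Longrightarrow> A \<in> smooth_circle \<Longrightarrow> bounded_op (weighted_shear m A)"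
  unfolding weighted_shear_twisted by (intro bounded_op_twisted_shear smooth_circle_const)

lemma linear_op_weighted_shear: "linear_op (weighted_shear m A)"
  by (simp add: linear_op_def weighted_shear_def algebra_simps)

lemma weighted_shear_weighted_shear:
  "weighted_shear m A (weighted_shear n B f) = weighted_shear (\<lambda>t. m t * n t) (\<lambda>t. A t + B t) f"
  by (simp add: weighted_shear_def algebra_simps)

lemma weighted_shear_id: "weighted_shear (\<lambda>_. 1) (\<lambda>_. 0) f = f"
  by (simp add: weighted_shear_def)

text \<open>
  The operator on test functions whose transpose is \<open>Psi a q\<close>.
\<close>

abbreviation conjugator :: "(real \<Rightarrow> real) \<Rightarrow> (real \<Rightarrow> complex) \<Rightarrow> cylfun \<Rightarrow> cylfun" where
  "conjugator a q \<equiv>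
     weighted_shear (\<lambda>t. exp (mean_free_primitive q t)) (mean_free_primitive a)"

abbreviation inv_conjugator :: "(real \<Rightarrow> real) \<Rightarrow> (real \<Rightarrow> complex) \<Rightarrow> cylfun \<Rightarrow> cylfun" where
  "inv_conjugator a q \<equiv>
     weighted_shear (\<lambda>t. exp (- mean_free_primitive q t)) (\<lambda>t. - mean_free_primitive a t)"

lemma conjugator_inverse:
  "conjugator a q (inv_conjugator a q f) = f" "inv_conjugator a q (conjugator a q f) = f"
  by (simp_all add: weighted_shear_weighted_shear weighted_shear_id flip: exp_add)

lemma bounded_op_conjugator:
  assumes "a \<in> smooth_circle" "q \<in> smooth_circle"
  shows "bounded_op (conjugator a q)" "bounded_op (inv_conjugator a q)"
  by (intro bounded_op_weighted_shear smooth_circle_exp smooth_circle_uminus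
      smooth_circle_mean_free_primitive assms)+

text \<open>
  Unfolding the dual definitions applies \<open>u\<close> to the test function obtained from \<open>f\<close> by the inverse transform,
  the modulation, the transform and finally the factor \<open>exp (Q(t))\<close>; the first three amount to a
  translation. Functionals are extensional, so each intermediate function has to be a Schwartz function
  for the definitions to unfold.
\<close>

lemma Psi_eq_transposed:
  assumes a: "a \<in> smooth_circle" and q: "q \<in> smooth_circle"
  shows "Psi a q u = transposed (conjugator a q) u"
proof
  fix f
  let ?A = "mean_free_primitive a"
  have A: "?A \<in> smooth_circle"
    by (rule smooth_circle_mean_free_primitive[OF a])
  show "Psi a q u f = transposed (conjugator a q) u f"
  proof (cases "f \<in> schwartz")
    case f: True
    let ?g = "\<lambda>t \<xi>. exp (\<i> * of_real \<xi> * of_real (?A t)) * inv_fourier f t \<xi>"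
    have inv: "inv_fourier f \<in> schwartz"
      using f by (rule bounded_op_schwartz[OF bounded_op_inv_fourier])
    have g: "?g \<in> schwartz"
      using bounded_op_schwartz[OF bounded_op_twisted_shear[OF smooth_circle_const[of 1] A
          smooth_circle_const[of 0]] inv]
      by (simp add: twisted_shear_def)
    have shear: "(\<lambda>t x. f t (x - ?A t)) \<in> schwartz"
      using bounded_op_schwartz[OF bounded_op_weighted_shear[OF smooth_circle_const[of 1] A] f]
      by (simp add: weighted_shear_def)
    have "Psi a q u f = Psi_q q u (fourier ?g)"
      using f inv g by (simp add: Psi_def Psi_a_def dist_inv_fourier_def dist_mult_def dist_fourier_def)
    also have "\<dots> = Psi_q q u (\<lambda>t x. f t (x - ?A t))"
      by (simp only: fourier_modulated_inv_fourier[OF f])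
    also have "\<dots> = transposed (conjugator a q) u f"
      using f shear by (simp add: Psi_q_def dist_mult_def transposed_def weighted_shear_def)
    finally show ?thesis .
  qed (simp add: Psi_def Psi_a_def dist_inv_fourier_def transposed_def)
qed

text \<open>
  In \<open>\<partial>\<^sub>t\<close> of the weighted shear, the derivative of the weight contributes \<open>q - q\<^sub>0\<close> and that of the shift
  contributes \<open>- (a - a\<^sub>0) \<partial>\<^sub>x\<close>: exactly what distinguishes the two transposed operators.
\<close>

lemma conjugator_transport_adjoint:
  assumes a: "a \<in> smooth_circle" and q: "q \<in> smooth_circle" and f: "f \<in> schwartz"
  shows "conjugator a q (transport_adjoint (\<lambda>t. circle_mean a) (\<lambda>t. circle_mean q) f) =
         transport_adjoint a q (conjugator a q f)"
proof (intro ext)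
  fix t x
  let ?A = "mean_free_primitive a" and ?Q = "mean_free_primitive q"
  let ?E = "\<lambda>t. exp (?Q t)"
  note smooth = smooth_circle_mean_free_primitive[OF a] smooth_circle_exp[OF smooth_circle_mean_free_primitive[OF q]]
  have A': "circle_deriv ?A t = a t - circle_mean a"
    by (rule vector_derivative_at[OF mean_free_primitive_derivative[OF a]])
  have E': "circle_deriv ?E t = (q t - circle_mean q) * ?E t"
    using field_vector_diff_chain_at[OF mean_free_primitive_derivative[OF q, of t] DERIV_exp]
    by (intro vector_derivative_at) (simp add: o_def)
  have "D_t (conjugator a q f) t x = (q t - circle_mean q) * ?E t * f t (x - ?A t) +
      ?E t * D_t f t (x - ?A t) - of_real (a t - circle_mean a) * (?E t * D_x f t (x - ?A t))"
    unfolding D_t_def[of "conjugator a q f"]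
    using twisted_shear_D_t[OF smooth(2) smooth_circle_const[of 0] smooth(1) schwartz_smooth[OF f], of x t]
    by (intro vector_derivative_at) (simp add: weighted_shear_twisted twisted_shear_def A' E')
  moreover have "D_x (conjugator a q f) t x = ?E t * D_x f t (x - ?A t)"
    unfolding D_x_def[of "conjugator a q f"]
    using twisted_shear_D_x[OF schwartz_smooth[OF f], of ?E "\<lambda>_. 0" ?A t x]
    by (intro vector_derivative_at) (simp add: weighted_shear_twisted twisted_shear_def)
  ultimately show "conjugator a q (transport_adjoint (\<lambda>t. circle_mean a) (\<lambda>t. circle_mean q) f) t x =
      transport_adjoint a q (conjugator a q f) t x"
    by (simp add: weighted_shear_def transport_adjoint_def algebra_simps)
qed

lemma Psi_tempered:
  assumes "a \<in> smooth_circle" "q \<in> smooth_circle" "u \<in> tempered"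
  shows "Psi a q u \<in> tempered"
  unfolding Psi_eq_transposed[OF assms(1,2)]
  by (intro tempered_transposed bounded_op_conjugator linear_op_weighted_shear assms)

lemma transport_op_tempered:
  assumes "a \<in> smooth_circle" "q \<in> smooth_circle" "u \<in> tempered"
  shows "transport_op a q u \<in> tempered"
  unfolding transport_op_eq_transposed[OF assms]
  by (intro tempered_transposed bounded_op_transport_adjoint linear_op_transport_adjoint assms)

text \<open>
  Stated for all extensional functionals, so that it covers the tempered distributions as well as the
  functionals \<open>regular_dist g\<close>.
\<close>

lemma Psi_inverse:
  assumes a: "a \<in> smooth_circle" and q: "q \<in> smooth_circle" and u: "u \<in> extensional schwartz"
  shows "transposed (inv_conjugator a q) (Psi a q u) = u" "Psi a q (transposed (inv_conjugator a q) u) = u"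
proof -
  note closed = bounded_op_schwartz[OF bounded_op_conjugator(1)[OF a q]]
    bounded_op_schwartz[OF bounded_op_conjugator(2)[OF a q]]
  show "transposed (inv_conjugator a q) (Psi a q u) = u" "Psi a q (transposed (inv_conjugator a q) u) = u"
    unfolding Psi_eq_transposed[OF a q]
    by (simp_all add: transposed_transposed closed conjugator_inverse transposed_id[OF u])
qed

lemma bij_betw_Psi:
  assumes a: "a \<in> smooth_circle" and q: "q \<in> smooth_circle"
  shows "bij_betw (Psi a q) tempered tempered"
proof (rule bij_betw_byWitness[where f' = "transposed (inv_conjugator a q)"])
  show "transposed (inv_conjugator a q) ` tempered \<subseteq> tempered"
    using tempered_transposed[OF bounded_op_conjugator(2)[OF a q] linear_op_weighted_shear] by blast
qed (use Psi_inverse[OF a q tempered_extensional] Psi_tempered[OF a q] in auto)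

lemma Psi_intertwines:
  assumes a: "a \<in> smooth_circle" and q: "q \<in> smooth_circle" and u: "u \<in> tempered"
  shows "mean_transport_op a q (Psi a q u) = Psi a q (transport_op a q u)"
proof -
  let ?L0 = "transport_adjoint (\<lambda>t. circle_mean a) (\<lambda>t. circle_mean q)"
  have const: "(\<lambda>t. circle_mean a) \<in> smooth_circle" "(\<lambda>t. circle_mean q) \<in> smooth_circle"
    by (rule smooth_circle_const)+
  have "mean_transport_op a q (Psi a q u) = transposed ?L0 (transposed (conjugator a q) u)"
    unfolding mean_transport_op_def
    by (subst transport_op_eq_transposed[OF const Psi_tempered[OF a q u]]) (simp only: Psi_eq_transposed[OF a q])
  also have "\<dots> = transposed (\<lambda>f. conjugator a q (?L0 f)) u"
    by (rule transposed_transposed[OF bounded_op_schwartz[OF bounded_op_transport_adjoint[OF const]]])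
  also have "\<dots> = transposed (\<lambda>f. transport_adjoint a q (conjugator a q f)) u"
    by (rule transposed_cong[OF conjugator_transport_adjoint[OF a q]])
  also have "\<dots> = transposed (conjugator a q) (transposed (transport_adjoint a q) u)"
    by (rule transposed_transposed[OF bounded_op_schwartz[OF bounded_op_conjugator(1)[OF a q]], symmetric])
  also have "\<dots> = Psi a q (transport_op a q u)"
    by (simp only: Psi_eq_transposed[OF a q] transport_op_eq_transposed[OF a q u])
  finally show ?thesis .
qed

subsection \<open>The conjugation on regular distributions\<close>

text \<open>
  Each slice \<open>{x. (t, x) \<in> X}\<close> of a set is merely translated by the shear.
\<close>

lemma lborel_shear:
  assumes A: "A \<in> borel_measurable borel"
  shows "distr lborel borel (\<lambda>(t, x). (t, x + A t)) = (lborel :: (real \<times> real) measure)"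
proof (rule measure_eqI)
  let ?h = "\<lambda>(t, x). (t, x + A t) :: real \<times> real"
  have h: "?h \<in> borel_measurable borel"
    unfolding borel_prod[symmetric] using A by measurable
  fix X assume "X \<in> sets (distr lborel borel ?h)"
  then have X: "X \<in> sets borel" by simp
  have hX: "?h -` X \<in> sets borel"
    using measurable_sets[OF h X] by simp
  have slice: "emeasure lborel (Pair t -` (?h -` X)) = emeasure lborel (Pair t -` X)" for t
  proof -
    have S: "Pair t -` X \<in> sets borel"
    proof -
      have "X \<in> sets (lborel \<Otimes>\<^sub>M lborel)"
        using X by (simp only: lborel_prod sets_lborel)
      from sets_Pair1[OF this] show ?thesis by simp
    qed
    have "emeasure lborel (Pair t -` X) = emeasure (distr lborel borel ((+) (A t))) (Pair t -` X)"
      by (simp add: lborel_distr_plus)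
    also have "\<dots> = emeasure lborel ((+) (A t) -` (Pair t -` X))"
      using S by (subst emeasure_distr) auto
    also have "(+) (A t) -` (Pair t -` X) = Pair t -` (?h -` X)"
      by (auto simp: add.commute)
    finally show ?thesis by simp
  qed
  have "emeasure (distr lborel borel ?h) X = emeasure lborel (?h -` X)"
    using h X by (simp add: emeasure_distr)
  also have "\<dots> = emeasure (lborel \<Otimes>\<^sub>M lborel) (?h -` X)"
    by (simp add: lborel_prod)
  also have "\<dots> = (\<integral>\<^sup>+ t. emeasure lborel (Pair t -` (?h -` X)) \<partial>lborel)"
    using hX by (intro lborel.emeasure_pair_measure_alt) (simp only: lborel_prod sets_lborel)
  also have "\<dots> = (\<integral>\<^sup>+ t. emeasure lborel (Pair t -` X) \<partial>lborel)"
    by (simp only: slice)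
  also have "\<dots> = emeasure (lborel \<Otimes>\<^sub>M lborel) X"
    using X by (intro lborel.emeasure_pair_measure_alt[symmetric]) (simp only: lborel_prod sets_lborel)
  finally show "emeasure (distr lborel borel ?h) X = emeasure lborel X"
    by (simp add: lborel_prod)
qed simp

lemma schwartz_measurable: "f \<in> schwartz \<Longrightarrow> (\<lambda>(t, x). f t x) \<in> borel_measurable borel"
  by (intro borel_measurable_continuous_onI schwartz_continuous)

text \<open>
  The substitution \<open>x \<mapsto> x + A(t)\<close> moves the shear from the test function to \<open>g\<close>; the weight \<open>m\<close>
  depends on \<open>t\<close> only and stays in place.
\<close>

lemma transposed_regular_dist:
  assumes m: "m \<in> smooth_circle" and A: "A \<in> smooth_circle" and g: "g \<in> schwartz"
  shows "transposed (weighted_shear m A) (regular_dist g) =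
    regular_dist (weighted_shear m (\<lambda>t. - A t) g)"
proof
  fix f
  let ?I = "\<lambda>p. indicat_real ({0..2 * pi} \<times> UNIV) p"
  let ?h = "\<lambda>(t, x). (t, x + A t) :: real \<times> real"
  show "transposed (weighted_shear m A) (regular_dist g) f = regular_dist (weighted_shear m (\<lambda>t. - A t) g) f"
  proof (cases "f \<in> schwartz")
    case f: True
    have Sf: "weighted_shear m A f \<in> schwartz"
      using f by (rule bounded_op_schwartz[OF bounded_op_weighted_shear[OF m A]])
    have A_meas: "A \<in> borel_measurable borel"
      by (intro borel_measurable_continuous_onI smooth_circle_continuous A)
    have h: "?h \<in> borel_measurable borel"
      unfolding borel_prod[symmetric] using A_meas by measurable
    let ?F = "\<lambda>p. ?I p *\<^sub>R (case p of (t, x) \<Rightarrow> g t x * weighted_shear m A f t x)"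
    have "({0..2 * pi} \<times> UNIV :: (real \<times> real) set) \<in> sets borel"
      by (intro borel_closed closed_Times) auto
    then have F: "?F \<in> borel_measurable borel"
      using schwartz_measurable[OF g] schwartz_measurable[OF Sf] unfolding case_prod_unfold by measurable
    have "transposed (weighted_shear m A) (regular_dist g) f = (LINT p|lborel. ?F p)"
      using f Sf by (simp add: transposed_def regular_dist_def set_lebesgue_integral_def)
    also have "\<dots> = (LINT p|distr lborel borel ?h. ?F p)"
      by (simp only: lborel_shear[OF A_meas])
    also have "\<dots> = (LINT p|lborel. ?F (?h p))"
      using h F by (intro integral_distr) auto
    also have "\<dots> = (LINT p|lborel. ?I p *\<^sub>R (case p of (t, x) \<Rightarrow> weighted_shear m (\<lambda>t. - A t) g t x * f t x))"
      by (intro Bochner_Integration.integral_cong refl)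
         (auto simp: weighted_shear_def indicator_def)
    also have "\<dots> = regular_dist (weighted_shear m (\<lambda>t. - A t) g) f"
      using f by (simp add: regular_dist_def set_lebesgue_integral_def)
    finally show ?thesis .
  qed (simp add: transposed_def regular_dist_def)
qed

lemma Psi_regular_dist_image:
  assumes a: "a \<in> smooth_circle" and q: "q \<in> smooth_circle"
  shows "Psi a q ` regular_dist ` schwartz = regular_dist ` schwartz"
proof -
  let ?A = "mean_free_primitive a" and ?Q = "mean_free_primitive q"
  have smooth: "?A \<in> smooth_circle" "(\<lambda>t. - ?A t) \<in> smooth_circle"
    "(\<lambda>t. exp (?Q t)) \<in> smooth_circle" "(\<lambda>t. exp (- ?Q t)) \<in> smooth_circle"
    using a q by (auto intro!: smooth_circle_exp smooth_circle_uminus smooth_circle_mean_free_primitive)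
  let ?R = "weighted_shear (\<lambda>t. exp (?Q t)) (\<lambda>t. - ?A t)"
  let ?R' = "weighted_shear (\<lambda>t. exp (- ?Q t)) ?A"
  have "?R ` schwartz = schwartz"
  proof
    show "?R ` schwartz \<subseteq> schwartz"
      using bounded_op_schwartz[OF bounded_op_weighted_shear[OF smooth(3,2)]] by blast
    show "schwartz \<subseteq> ?R ` schwartz"
    proof
      fix g assume "g \<in> schwartz"
      then have "?R' g \<in> schwartz"
        by (rule bounded_op_schwartz[OF bounded_op_weighted_shear[OF smooth(4,1)]])
      moreover have "g = ?R (?R' g)"
        by (simp add: weighted_shear_weighted_shear weighted_shear_id flip: exp_add)
      ultimately show "g \<in> ?R ` schwartz" by blast
    qed
  qed
  moreover have "Psi a q (regular_dist g) = regular_dist (?R g)" if "g \<in> schwartz" for g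
    using transposed_regular_dist[OF smooth(3,1) that] by (simp add: Psi_eq_transposed[OF a q])
  then have "Psi a q ` regular_dist ` schwartz = regular_dist ` ?R ` schwartz"
    by (simp add: image_image)
  ultimately show ?thesis by simp
qed

lemma Psi_reflects_regular:
  assumes a: "a \<in> smooth_circle" and q: "q \<in> smooth_circle" and u: "u \<in> extensional schwartz"
  shows "Psi a q u \<in> regular_dist ` schwartz \<longleftrightarrow> u \<in> regular_dist ` schwartz"
proof
  assume "Psi a q u \<in> regular_dist ` schwartz"
  then have "Psi a q u \<in> Psi a q ` regular_dist ` schwartz"
    by (simp only: Psi_regular_dist_image[OF a q])
  then obtain g where g: "g \<in> schwartz" "Psi a q u = Psi a q (regular_dist g)"
    by blast
  have "u = transposed (inv_conjugator a q) (Psi a q u)"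
    by (rule Psi_inverse(1)[OF a q u, symmetric])
  also have "\<dots> = regular_dist g"
    unfolding g(2) by (rule Psi_inverse(1)[OF a q regular_dist_extensional])
  finally show "u \<in> regular_dist ` schwartz"
    using g(1) by blast
next
  assume "u \<in> regular_dist ` schwartz"
  then show "Psi a q u \<in> regular_dist ` schwartz"
    using Psi_regular_dist_image[OF a q] by blast
qed

theorem corollary3p3:
  fixes a :: "real \<Rightarrow> real" and q :: "real \<Rightarrow> complex"
  assumes "a \<in> smooth_circle" and "q \<in> smooth_circle"
  shows "bij_betw (Psi a q) tempered tempered \<and>
         (\<forall>u\<in>tempered. mean_transport_op a q (Psi a q u) = Psi a q (transport_op a q u)) \<and>
         (\<forall>u\<in>tempered. transport_op a q (inv_into tempered (Psi a q) u)
                      = inv_into tempered (Psi a q) (mean_transport_op a q u)) \<and>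
         (SGH (transport_op a q) \<longleftrightarrow> SGH (mean_transport_op a q))"
proof (intro conjI ballI)
  let ?inv = "inv_into tempered (Psi a q)"
  show bij: "bij_betw (Psi a q) tempered tempered"
    by (rule bij_betw_Psi[OF assms])
  have inv: "?inv u \<in> tempered" "Psi a q (?inv u) = u" if "u \<in> tempered" for u
    using bij that by (auto simp: bij_betw_def inv_into_into f_inv_into_f)
  show intertwine: "mean_transport_op a q (Psi a q u) = Psi a q (transport_op a q u)" if "u \<in> tempered" for u
    by (rule Psi_intertwines[OF assms that])
  show "transport_op a q (?inv u) = ?inv (mean_transport_op a q u)" if u: "u \<in> tempered" for u
  proof -
    have "mean_transport_op a q u = Psi a q (transport_op a q (?inv u))"
      using intertwine[OF inv(1)[OF u]] inv(2)[OF u] by simp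
    moreover have "transport_op a q (?inv u) \<in> tempered"
      by (rule transport_op_tempered[OF assms inv(1)[OF u]])
    ultimately show ?thesis
      using bij by (simp add: bij_betw_def inv_into_f_f)
  qed
  have regular: "Psi a q u \<in> regular_dist ` schwartz \<longleftrightarrow> u \<in> regular_dist ` schwartz"
    and regular_L: "mean_transport_op a q (Psi a q u) \<in> regular_dist ` schwartz \<longleftrightarrow>
      transport_op a q u \<in> regular_dist ` schwartz" if u: "u \<in> tempered" for u
    using Psi_reflects_regular[OF assms tempered_extensional] u intertwine[OF u]
      transport_op_tempered[OF assms u] by auto
  have "SGH (mean_transport_op a q) \<longleftrightarrow>
      (\<forall>u\<in>Psi a q ` tempered. mean_transport_op a q u \<in> regular_dist ` schwartz \<longrightarrow> u \<in> regular_dist ` schwartz)"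
    using bij by (simp add: SGH_def bij_betw_def)
  also have "\<dots> \<longleftrightarrow> SGH (transport_op a q)"
    by (simp add: SGH_def regular regular_L)
  finally show "SGH (transport_op a q) \<longleftrightarrow> SGH (mean_transport_op a q)"
    by blast
qed

end
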